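(* Let $H$ be a subgroup of a finite group $G$ and $g\in G$. Then the number $\tilde\zeta_3(g)$ of elements $(g_1,h_2,g_3)\in G\times H\times G$ satisfying $g_1h_2g_1^{-1}g_3h_2^{-1}g_3^{-1}=g$ defines a character of $G$ and is given by $$\tilde\zeta_3(g)=\sum_{\chi\in\operatorname{Irr}(G)}\frac{|G||H|[\chi_H,\chi_H]}{\chi(1)}\,\chi(g).$$
   Context: $\operatorname{Irr}(G)$ is the set of irreducible complex characters of $G$; $\chi_H$ is the restriction of $\chi$ to $H$; $[\chi_H,\chi_H]$ is the usual inner product of class functions of $H$. "Character" means character of a complex representation. *)

theory Defs
  imports
    Complex_Main
    "HOL-Algebra.Coset"
    "Jordan_Normal_Form.VS_Connect"
begin

abbreviation GL :: "nat \<Rightarrow> complex mat monoid" where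
  "GL n \<equiv> units_of (ring_mat TYPE(complex) n ())"

definition mat_trace :: "complex mat \<Rightarrow> complex" where
  "mat_trace A = (\<Sum>i<dim_row A. A $$ (i, i))"

text \<open>Degrees are positive, so the zero function is not a character.\<close>

definition representation ::
    "('a, 'm) monoid_scheme \<Rightarrow> nat \<Rightarrow> ('a \<Rightarrow> complex mat) \<Rightarrow> bool" where
  "representation G n \<rho> \<longleftrightarrow> n > 0 \<and> \<rho> \<in> hom G (GL n)"

definition irreducible_representation ::
    "('a, 'm) monoid_scheme \<Rightarrow> nat \<Rightarrow> ('a \<Rightarrow> complex mat) \<Rightarrow> bool" where
  "irreducible_representation G n \<rho> \<longleftrightarrow> representation G n \<rho> \<and>
     (\<forall>W. VectorSpace.subspace class_ring W (module_vec TYPE(complex) n) \<and>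
          (\<forall>g\<in>carrier G. \<forall>w\<in>W. \<rho> g *\<^sub>v w \<in> W)
        \<longrightarrow> W = {0\<^sub>v n} \<or> W = carrier_vec n)"

text \<open>Characters are restricted to the carrier (with value \<^term>\<open>undefined\<close> outside it), so that
  characters agreeing on the group are equal and \<open>Irr G\<close> contains each irreducible character
  exactly once.\<close>

definition character_of ::
    "('a, 'm) monoid_scheme \<Rightarrow> ('a \<Rightarrow> complex mat) \<Rightarrow> 'a \<Rightarrow> complex" where
  "character_of G \<rho> = (\<lambda>g\<in>carrier G. mat_trace (\<rho> g))"

definition characters :: "('a, 'm) monoid_scheme \<Rightarrow> ('a \<Rightarrow> complex) set" where
  "characters G = {character_of G \<rho> |n \<rho>. representation G n \<rho>}"

definition Irr :: "('a, 'm) monoid_scheme \<Rightarrow> ('a \<Rightarrow> complex) set" where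
  "Irr G = {character_of G \<rho> |n \<rho>. irreducible_representation G n \<rho>}"

definition class_inner ::
    "('a, 'm) monoid_scheme \<Rightarrow> ('a \<Rightarrow> complex) \<Rightarrow> ('a \<Rightarrow> complex) \<Rightarrow> complex" where
  "class_inner G \<phi> \<psi> = (\<Sum>x\<in>carrier G. \<phi> x * cnj (\<psi> x)) / of_nat (card (carrier G))"

definition zeta3 :: "('a, 'm) monoid_scheme \<Rightarrow> 'a set \<Rightarrow> 'a \<Rightarrow> nat" where
  "zeta3 G H g = card {(g1, h2, g3) \<in> carrier G \<times> H \<times> carrier G.
     g1 \<otimes>\<^bsub>G\<^esub> h2 \<otimes>\<^bsub>G\<^esub> inv\<^bsub>G\<^esub> g1 \<otimes>\<^bsub>G\<^esub> g3 \<otimes>\<^bsub>G\<^esub> inv\<^bsub>G\<^esub> h2 \<otimes>\<^bsub>G\<^esub> inv\<^bsub>G\<^esub> g3 = g}"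

end

theory Submission
  imports Defs "Jordan_Normal_Form.Schur_Decomposition" "HOL-Algebra.Multiplicative_Group"
begin

text \<open>The regular character \<open>\<Sum>\<chi>. \<chi>(1) \<chi>\<close>, taken over the irreducible characters, is \<open>|G|\<close> times the
  indicator of the identity (\<open>regular_character\<close>). Summing it over the triples \<open>(g1, h2, g3)\<close> turns the
  count of solutions into a sum over irreducible characters. By Schur's lemma the sum of \<open>\<rho> (x h x\<inverse>)\<close>
  over \<open>x\<close> is the scalar \<open>|G| \<chi>(h) / \<chi>(1)\<close>; using this for both conjugates leaves the coefficient
  \<open>|G| / \<chi>(1) \<cdot> \<Sum>h. \<chi>(h) \<chi>(h\<inverse>)\<close>, with \<open>h\<close> ranging over \<open>H\<close>, and the last sum is
  \<open>|H| [\<chi>\<^sub>H, \<chi>\<^sub>H]\<close> (\<open>zeta3_formula\<close>, \<open>class_inner_subgroup\<close>).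

  The counting function is a character because these coefficients are natural numbers, not all zero.
  The quotient \<open>|G| / \<chi>(1)\<close> is an integer since its square is the scalar by which the sum of all
  commutators acts, which is an eigenvalue of an integer matrix (\<open>degree_dvd_order\<close>). The inner product
  \<open>[\<chi>\<^sub>H, \<chi>\<^sub>H]\<close> is the trace of an idempotent, the projection of the square matrices onto those commuting with
  \<open>H\<close> (\<open>class_inner_subgroup_Nats\<close>).

  The character theory of \<open>G\<close> that this uses is derived from matrices over the complex numbers:
  orthogonality follows from averaging matrix units (\<open>character_orthogonality\<close>), finiteness of the set
  of irreducible characters from Bessel's inequality (\<open>finite_Irr\<close>), and completeness from the fact
  that a Hermitian matrix commuting with the regular representation and vanishing on every irreducible
  representation is zero (\<open>class_function_eq_zero\<close>).\<close>

section \<open>Sums, traces and powers of complex matrices\<close>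

lemma index_mult_sum:
  assumes "A \<in> carrier_mat k r" "B \<in> carrier_mat r c" "i < k" "j < c"
  shows "(A * B) $$ (i, j) = (\<Sum>l<r. A $$ (i, l) * B $$ (l, j))"
  using assms by (auto simp: scalar_prod_def atLeast0LessThan)

text \<open>Matrices of different sizes share one type, so there is no zero matrix to start a
  \<^const>\<open>sum\<close> from. The sum of a family of \<open>r \<times> c\<close> matrices is therefore taken entrywise, with the
  size as explicit arguments.\<close>

definition msum :: "nat \<Rightarrow> nat \<Rightarrow> ('b \<Rightarrow> complex mat) \<Rightarrow> 'b set \<Rightarrow> complex mat" where
  "msum r c F S = mat r c (\<lambda>ij. \<Sum>x\<in>S. F x $$ ij)"

lemma msum_carrier [simp, intro]: "msum r c F S \<in> carrier_mat r c"
  by (simp add: msum_def)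

lemma index_msum: "i < r \<Longrightarrow> j < c \<Longrightarrow> msum r c F S $$ (i, j) = (\<Sum>x\<in>S. F x $$ (i, j))"
  by (simp add: msum_def)

lemma msum_cong: "(\<And>x. x \<in> S \<Longrightarrow> F x = F' x) \<Longrightarrow> msum r c F S = msum r c F' S"
  by (simp add: msum_def)

lemma mult_msum:
  assumes "B \<in> carrier_mat k r" "\<And>x. x \<in> S \<Longrightarrow> F x \<in> carrier_mat r c"
  shows "B * msum r c F S = msum k c (\<lambda>x. B * F x) S"
proof (rule eq_matI)
  fix i j assume "i < dim_row (msum k c (\<lambda>x. B * F x) S)" "j < dim_col (msum k c (\<lambda>x. B * F x) S)"
  then have ij: "i < k" "j < c" by (auto simp: msum_def)
  have "(B * msum r c F S) $$ (i, j) = (\<Sum>l<r. \<Sum>x\<in>S. B $$ (i, l) * F x $$ (l, j))"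
    using index_mult_sum[OF assms(1) msum_carrier ij] ij by (simp add: index_msum sum_distrib_left)
  also have "\<dots> = (\<Sum>x\<in>S. (B * F x) $$ (i, j))"
    by (subst sum.swap) (simp add: index_mult_sum[OF assms(1) assms(2) ij])
  finally show "(B * msum r c F S) $$ (i, j) = msum k c (\<lambda>x. B * F x) S $$ (i, j)"
    using ij by (simp add: index_msum)
qed (use assms(1) in \<open>auto simp: msum_def\<close>)

lemma msum_mult:
  assumes "B \<in> carrier_mat c k" "\<And>x. x \<in> S \<Longrightarrow> F x \<in> carrier_mat r c"
  shows "msum r c F S * B = msum r k (\<lambda>x. F x * B) S"
proof (rule eq_matI)
  fix i j assume "i < dim_row (msum r k (\<lambda>x. F x * B) S)" "j < dim_col (msum r k (\<lambda>x. F x * B) S)"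
  then have ij: "i < r" "j < k" by (auto simp: msum_def)
  have "(msum r c F S * B) $$ (i, j) = (\<Sum>l<c. \<Sum>x\<in>S. F x $$ (i, l) * B $$ (l, j))"
    using index_mult_sum[OF msum_carrier assms(1) ij] ij by (simp add: index_msum sum_distrib_right)
  also have "\<dots> = (\<Sum>x\<in>S. (F x * B) $$ (i, j))"
    by (subst sum.swap) (simp add: index_mult_sum[OF assms(2) assms(1) ij])
  finally show "(msum r c F S * B) $$ (i, j) = msum r k (\<lambda>x. F x * B) S $$ (i, j)"
    using ij by (simp add: index_msum)
qed (use assms(1) in \<open>auto simp: msum_def\<close>)

lemma msum_reindex:
  assumes "bij_betw h S T" "\<And>x. x \<in> S \<Longrightarrow> F (h x) = F' x"
  shows "msum r c F T = msum r c F' S"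
proof -
  have "(\<Sum>x\<in>T. F x $$ ij) = (\<Sum>x\<in>S. F' x $$ ij)" for ij
    using sum.reindex_bij_betw[OF assms(1), of "\<lambda>x. F x $$ ij"] assms(2) by (simp cong: sum.cong)
  then show ?thesis by (simp add: msum_def)
qed

lemma mat_trace_eq: "A \<in> carrier_mat n k \<Longrightarrow> mat_trace A = (\<Sum>i<n. A $$ (i, i))"
  by (auto simp: mat_trace_def)

lemma mat_trace_msum:
  "\<lbrakk>\<And>x. x \<in> S \<Longrightarrow> F x \<in> carrier_mat n n\<rbrakk> \<Longrightarrow> mat_trace (msum n n F S) = (\<Sum>x\<in>S. mat_trace (F x))"
  by (simp add: mat_trace_eq[of _ n n] index_msum) (rule sum.swap)

lemma mat_trace_smult: "A \<in> carrier_mat n n \<Longrightarrow> mat_trace (c \<cdot>\<^sub>m A) = c * mat_trace A"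
  by (simp add: mat_trace_eq[of _ n n] sum_distrib_left)

lemma mat_trace_one: "mat_trace (1\<^sub>m n) = of_nat n"
  by (simp add: mat_trace_def)

lemma mat_trace_mult_comm:
  assumes "A \<in> carrier_mat n m" "B \<in> carrier_mat m n"
  shows "mat_trace (A * B) = mat_trace (B * A)"
proof -
  have "mat_trace (A * B) = (\<Sum>i<n. \<Sum>l<m. A $$ (i, l) * B $$ (l, i))"
    using assms by (subst mat_trace_eq[of _ n n]) (auto simp: index_mult_sum[OF assms] simp del: index_mult_mat intro!: sum.cong)
  also have "\<dots> = (\<Sum>l<m. \<Sum>i<n. B $$ (l, i) * A $$ (i, l))"
    by (subst sum.swap) (simp add: mult.commute)
  also have "\<dots> = mat_trace (B * A)"
    using assms by (subst mat_trace_eq[of _ m m]) (auto simp: index_mult_sum[OF assms(2,1)] simp del: index_mult_mat intro!: sum.cong)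
  finally show ?thesis .
qed

lemma upper_triangular_mult:
  fixes A B :: "complex mat"
  assumes A: "A \<in> carrier_mat n n" and B: "B \<in> carrier_mat n n"
    and uA: "upper_triangular A" and uB: "upper_triangular B"
  shows "upper_triangular (A * B)"
    and "i < n \<Longrightarrow> (A * B) $$ (i, i) = A $$ (i, i) * B $$ (i, i)"
proof -
  have a: "A $$ (i, l) = 0" if "l < i" "i < n" for i l using uA A that by auto
  have b: "B $$ (i, l) = 0" if "l < i" "i < n" for i l using uB B that by auto
  show "upper_triangular (A * B)"
  proof (rule upper_triangularI)
    fix i j assume "j < i" "i < dim_row (A * B)"
    then have ij: "j < i" "i < n" "j < n" using A by auto
    have "A $$ (i, l) * B $$ (l, j) = 0" if "l < n" for l
      using a[of l i] b[of j l] that ij by (cases "l < i") auto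
    then show "(A * B) $$ (i, j) = 0"
      unfolding index_mult_sum[OF A B ij(2,3)] by (intro sum.neutral) auto
  qed
  assume i: "i < n"
  have "(A * B) $$ (i, i) = (\<Sum>l<n. if l = i then A $$ (i, i) * B $$ (i, i) else 0)"
    unfolding index_mult_sum[OF A B i i]
  proof (rule sum.cong)
    fix l assume "l \<in> {..<n}"
    then show "A $$ (i, l) * B $$ (l, i) = (if l = i then A $$ (i, i) * B $$ (i, i) else 0)"
      using a[of l i] b[of i l] i by (cases l i rule: linorder_cases) auto
  qed simp
  then show "(A * B) $$ (i, i) = A $$ (i, i) * B $$ (i, i)" using i by simp
qed

lemma upper_triangular_pow:
  fixes A :: "complex mat"
  assumes A: "A \<in> carrier_mat n n" and uA: "upper_triangular A"
  shows "upper_triangular (A ^\<^sub>m k) \<and> (\<forall>i<n. (A ^\<^sub>m k) $$ (i, i) = A $$ (i, i) ^ k)"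
proof (induction k)
  case 0
  then show ?case using A by auto
next
  case (Suc k)
  have "A ^\<^sub>m k \<in> carrier_mat n n" using A by simp
  from upper_triangular_mult[OF this A _ uA] Suc show ?case by simp
qed

text \<open>By Schur triangularisation, one list of eigenvalues computes the traces of all powers.\<close>

lemma mat_trace_pow:
  fixes A :: "complex mat"
  assumes A: "A \<in> carrier_mat n n"
  obtains t where "\<And>k. mat_trace (A ^\<^sub>m k) = (\<Sum>i<n. t i ^ k)"
    and "\<And>i. i < n \<Longrightarrow> eigenvalue A (t i)"
proof -
  obtain as where as: "char_poly A = (\<Prod>a\<leftarrow>as. [:- a, 1:])"
    using char_poly_factorized[OF A] by blast
  obtain B where B: "B \<in> carrier_mat n n" and uB: "upper_triangular B" and sim: "similar_mat A B"
    using schur_decomposition_exists[OF A as] by blast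
  show ?thesis
  proof (rule that[of "\<lambda>i. B $$ (i, i)"])
    fix k
    obtain P Q where wit: "similar_mat_wit A B P Q" using sim unfolding similar_mat_def by blast
    note PQ = similar_mat_witD2[OF A wit]
    have eq: "A ^\<^sub>m k = P * (B ^\<^sub>m k) * Q" using wit by (rule similar_mat_wit_pow_id)
    have Bk: "B ^\<^sub>m k \<in> carrier_mat n n" using B by simp
    have "mat_trace (A ^\<^sub>m k) = mat_trace (Q * (P * (B ^\<^sub>m k)))"
      unfolding eq using PQ Bk by (intro mat_trace_mult_comm) auto
    also have "Q * (P * (B ^\<^sub>m k)) = (Q * P) * (B ^\<^sub>m k)"
      using assoc_mult_mat[OF PQ(7,6) Bk] by simp
    also have "\<dots> = B ^\<^sub>m k" using PQ Bk by simp
    finally show "mat_trace (A ^\<^sub>m k) = (\<Sum>i<n. (B $$ (i, i)) ^ k)"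
      using upper_triangular_pow[OF B uB, of k] Bk by (simp add: mat_trace_eq)
  next
    fix i assume i: "i < n"
    have "char_poly A = char_poly B" using sim by (rule char_poly_similar)
    also have "\<dots> = (\<Prod>a\<leftarrow>diag_mat B. [:- a, 1:])"
      using char_poly_upper_triangular[OF B uB] .
    finally have "poly (char_poly A) (B $$ (i, i)) = (\<Prod>a\<leftarrow>diag_mat B. B $$ (i, i) - a)"
      by (simp add: poly_prod_list o_def)
    also have "\<dots> = 0"
      using i B by (auto simp: prod_list_zero_iff diag_mat_def)
    finally show "eigenvalue A (B $$ (i, i))" using eigenvalue_root_char_poly[OF A] by simp
  qed
qed

lemma sum_in_Nats: "(\<And>x. x \<in> S \<Longrightarrow> f x \<in> \<nat>) \<Longrightarrow> sum f S \<in> \<nat>"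
  by (induction S rule: infinite_finite_induct) auto

lemma mat_trace_idempotent:
  fixes A :: "complex mat"
  assumes A: "A \<in> carrier_mat n n" and "A * A = A"
  shows "mat_trace A \<in> \<nat>"
proof -
  obtain t where t: "\<And>k. mat_trace (A ^\<^sub>m k) = (\<Sum>i<n. t i ^ k)"
    and ev: "\<And>i. i < n \<Longrightarrow> eigenvalue A (t i)" using mat_trace_pow[OF A] by blast
  have "t i \<in> \<nat>" if i: "i < n" for i
  proof -
    obtain v where v: "v \<in> carrier_vec n" "v \<noteq> 0\<^sub>v n" "A *\<^sub>v v = t i \<cdot>\<^sub>v v"
      using ev[OF i] A unfolding eigenvalue_def eigenvector_def by auto
    have "t i \<cdot>\<^sub>v v = A *\<^sub>v (A *\<^sub>v v)" using assms v assoc_mult_mat_vec[OF A A v(1)] by simp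
    also have "\<dots> = t i \<cdot>\<^sub>v (t i \<cdot>\<^sub>v v)" using v A by (simp add: mult_mat_vec)
    finally have eq: "t i \<cdot>\<^sub>v v = t i \<cdot>\<^sub>v (t i \<cdot>\<^sub>v v)" .
    obtain l where l: "l < n" "v $ l \<noteq> 0"
      using v(1,2) by (metis carrier_vecD eq_vecI index_zero_vec)
    have "t i * v $ l = t i * (t i * v $ l)" using arg_cong[OF eq, of "\<lambda>v. v $ l"] l v by simp
    then have "t i = 0 \<or> t i = 1" using l by auto
    then show ?thesis by auto
  qed
  then show ?thesis using t[of 1] A by (auto intro!: sum_in_Nats)
qed

lemma eigenvalue_int_mat_algebraic_int:
  fixes A :: "int mat" and x :: complex
  assumes A: "A \<in> carrier_mat n n" and "eigenvalue (map_mat of_int A) x"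
  shows "algebraic_int x"
proof -
  have "map_mat of_int A \<in> carrier_mat n n" using A by simp
  then have "poly (char_poly (map_mat of_int A)) x = 0"
    using assms(2) eigenvalue_root_char_poly by blast
  then have "poly (map_poly of_int (char_poly A)) x = 0"
    using of_int_hom.char_poly_hom[OF A] by metis
  moreover have "lead_coeff (char_poly A) = 1" using degree_monic_char_poly[OF A] by simp
  ultimately show ?thesis unfolding algebraic_int_altdef_ipoly by blast
qed

section \<open>Representations and Schur's lemma\<close>

text \<open>Linear subspaces of the space of column vectors of length \<open>n\<close>.\<close>

abbreviation is_subspace :: "nat \<Rightarrow> complex vec set \<Rightarrow> bool" where
  "is_subspace n W \<equiv> VectorSpace.subspace class_ring W (module_vec TYPE(complex) n)"

lemma is_subspace_iff:
  "is_subspace n W \<longleftrightarrow> W \<subseteq> carrier_vec n \<and> 0\<^sub>v n \<in> W \<and>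
     (\<forall>v\<in>W. \<forall>w\<in>W. v + w \<in> W) \<and> (\<forall>c. \<forall>v\<in>W. c \<cdot>\<^sub>v v \<in> W)"
  using vec_vs[of n, where 'a = complex] vec_module[of n, where 'a = complex]
  by (auto simp: VectorSpace.subspace_def submodule_def module_vec_simps)

lemma mult_mat_zero_vec: "A \<in> carrier_mat m n \<Longrightarrow> A *\<^sub>v 0\<^sub>v n = (0\<^sub>v m :: complex vec)"
  by (intro eq_vecI) auto

lemma mult_mat_unit_vec:
  "A \<in> carrier_mat m n \<Longrightarrow> j < n \<Longrightarrow> A *\<^sub>v unit_vec n j = col (A :: complex mat) j"
  by (intro eq_vecI) (auto simp: scalar_prod_right_unit[of _ n])

lemma scalar_mat_mult_vec:
  assumes "v \<in> carrier_vec n" shows "(c \<cdot>\<^sub>m 1\<^sub>m n) *\<^sub>v v = c \<cdot>\<^sub>v (v :: complex vec)"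
  using assms by (intro eq_vecI) (auto simp: scalar_prod_left_unit[of _ n])

lemma mat_zeroI:
  fixes A :: "complex mat"
  assumes A: "A \<in> carrier_mat m n" and z: "\<And>v. v \<in> carrier_vec n \<Longrightarrow> A *\<^sub>v v = 0\<^sub>v m"
  shows "A = 0\<^sub>m m n"
proof (rule mat_col_eqI)
  fix j assume "j < dim_col (0\<^sub>m m n :: complex mat)"
  then show "col A j = col (0\<^sub>m m n) j"
    using z[of "unit_vec n j"] mult_mat_unit_vec[OF A] by simp
qed (use A in auto)

lemma mat_of_solutions:
  fixes A :: "complex mat"
  assumes A: "A \<in> carrier_mat m n" and C: "C \<in> carrier_mat m k"
    and ex: "\<And>j. j < k \<Longrightarrow> \<exists>v\<in>carrier_vec n. A *\<^sub>v v = col C j"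
  obtains B where "B \<in> carrier_mat n k" "A * B = C"
proof -
  obtain f where f: "\<And>j. j < k \<Longrightarrow> f j \<in> carrier_vec n \<and> A *\<^sub>v f j = col C j" using ex by metis
  define B where "B = mat_of_cols n (map f [0..<k])"
  have B: "B \<in> carrier_mat n k" by (auto simp: B_def)
  have "col B j = f j" if "j < k" for j using that f by (auto simp: B_def)
  then have "col (A * B) j = col C j" if "j < k" for j
    using that f A B by (subst col_mult2[of A m n B k]) auto
  then have "A * B = C" using A B C by (intro mat_col_eqI) auto
  with B show ?thesis using that by blast
qed

text \<open>Finite groups, written multiplicatively with a carrier set.\<close>

locale fin_group = group G for G (structure) +
  assumes fin: "finite (carrier G)"
begin

lemma rep_degree: "representation G n \<rho> \<Longrightarrow> n > 0"
  by (simp add: representation_def)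

lemma rep_carrier: "representation G n \<rho> \<Longrightarrow> g \<in> carrier G \<Longrightarrow> \<rho> g \<in> carrier_mat n n"
  by (auto simp: representation_def hom_def units_of_def Units_def ring_mat_simps)

lemma rep_mult:
  "representation G n \<rho> \<Longrightarrow> g \<in> carrier G \<Longrightarrow> h \<in> carrier G \<Longrightarrow> \<rho> (g \<otimes> h) = \<rho> g * \<rho> h"
  by (auto simp: representation_def hom_def units_of_def ring_mat_simps)

lemma rep_one:
  assumes r: "representation G n \<rho>" shows "\<rho> \<one> = 1\<^sub>m n"
proof -
  have "\<rho> \<one> \<in> Units (ring_mat TYPE(complex) n ())"
    using r by (auto simp: representation_def hom_def units_of_def)
  then obtain B where B: "B \<in> carrier_mat n n" "B * \<rho> \<one> = 1\<^sub>m n" "\<rho> \<one> \<in> carrier_mat n n"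
    by (auto simp: Units_def ring_mat_simps)
  have "B * (\<rho> \<one> * \<rho> \<one>) = B * \<rho> \<one>" using rep_mult[OF r, of \<one> \<one>] by simp
  then have "(B * \<rho> \<one>) * \<rho> \<one> = B * \<rho> \<one>"
    using assoc_mult_mat[OF B(1,3,3)] by simp
  then show ?thesis using B by simp
qed

lemma rep_inv_left: "representation G n \<rho> \<Longrightarrow> g \<in> carrier G \<Longrightarrow> \<rho> (inv g) * \<rho> g = 1\<^sub>m n"
  by (metis inv_closed l_inv rep_mult rep_one)

lemma representationI:
  assumes "n > 0" and c: "\<And>g. g \<in> carrier G \<Longrightarrow> \<rho> g \<in> carrier_mat n n"
    and m: "\<And>g h. g \<in> carrier G \<Longrightarrow> h \<in> carrier G \<Longrightarrow> \<rho> (g \<otimes> h) = \<rho> g * \<rho> h"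
    and "\<rho> \<one> = 1\<^sub>m n"
  shows "representation G n \<rho>"
proof -
  have "\<rho> g \<in> Units (ring_mat TYPE(complex) n ())" if g: "g \<in> carrier G" for g
    using g c[OF g] c[OF inv_closed[OF g]] m[of g "inv g"] m[of "inv g" g] assms(4)
    by (auto simp: Units_def ring_mat_simps intro!: bexI[of _ "\<rho> (inv g)"])
  then show ?thesis
    using assms by (auto simp: representation_def hom_def units_of_def ring_mat_simps)
qed

lemma irr_rep: "irreducible_representation G n \<rho> \<Longrightarrow> representation G n \<rho>"
  by (simp add: irreducible_representation_def)

lemma character_of_eq: "g \<in> carrier G \<Longrightarrow> character_of G \<rho> g = mat_trace (\<rho> g)"
  by (simp add: character_of_def)

lemma character_of_one: "representation G n \<rho> \<Longrightarrow> character_of G \<rho> \<one> = of_nat n"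
  by (simp add: character_of_eq rep_one mat_trace_one)

lemma irr_subspace:
  assumes "irreducible_representation G n \<rho>" "W \<subseteq> carrier_vec n" "0\<^sub>v n \<in> W"
    "\<And>v w. v \<in> W \<Longrightarrow> w \<in> W \<Longrightarrow> v + w \<in> W" "\<And>c v. v \<in> W \<Longrightarrow> c \<cdot>\<^sub>v v \<in> W"
    "\<And>g w. g \<in> carrier G \<Longrightarrow> w \<in> W \<Longrightarrow> \<rho> g *\<^sub>v w \<in> W"
  shows "W = {0\<^sub>v n} \<or> W = carrier_vec n"
proof -
  have "is_subspace n W" using assms(2-5) by (simp add: is_subspace_iff)
  moreover have "\<forall>g\<in>carrier G. \<forall>w\<in>W. \<rho> g *\<^sub>v w \<in> W" using assms(6) by simp
  ultimately show ?thesis using assms(1) by (simp add: irreducible_representation_def)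
qed

text \<open>The kernel and the range of an intertwiner are invariant, so irreducibility leaves only the
  trivial possibilities for them.\<close>

lemma irr_kernel:
  assumes r: "irreducible_representation G n \<rho>" and r': "representation G m \<rho>'"
    and A: "A \<in> carrier_mat m n"
    and eq: "\<And>g. g \<in> carrier G \<Longrightarrow> \<rho>' g * A = A * \<rho> g"
    and v: "v \<in> carrier_vec n" "v \<noteq> 0\<^sub>v n" "A *\<^sub>v v = 0\<^sub>v m"
  shows "A = 0\<^sub>m m n"
proof -
  note rc = rep_carrier[OF irr_rep[OF r]] and rc' = rep_carrier[OF r']
  define W where "W = {w \<in> carrier_vec n. A *\<^sub>v w = 0\<^sub>v m}"
  have "W = {0\<^sub>v n} \<or> W = carrier_vec n"
  proof (rule irr_subspace[OF r])
    fix g w assume g: "g \<in> carrier G" and w: "w \<in> W"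
    then have wc: "w \<in> carrier_vec n" "A *\<^sub>v w = 0\<^sub>v m" by (auto simp: W_def)
    have "A *\<^sub>v (\<rho> g *\<^sub>v w) = (A * \<rho> g) *\<^sub>v w" using A rc[OF g] wc by simp
    also have "\<dots> = \<rho>' g *\<^sub>v (A *\<^sub>v w)" unfolding eq[OF g, symmetric] using A rc'[OF g] wc(1) by simp
    also have "\<dots> = 0\<^sub>v m" unfolding wc(2) using rc'[OF g] by (rule mult_mat_zero_vec)
    finally show "\<rho> g *\<^sub>v w \<in> W" using rc[OF g] wc by (auto simp: W_def)
  qed (use A in \<open>auto simp: W_def mult_add_distrib_mat_vec mult_mat_vec\<close>)
  then have "W = carrier_vec n" using v by (auto simp: W_def)
  then show ?thesis using mat_zeroI[OF A] by (auto simp: W_def)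
qed

lemma irr_range:
  assumes r: "representation G n \<rho>" and r': "irreducible_representation G m \<rho>'"
    and A: "A \<in> carrier_mat m n"
    and eq: "\<And>g. g \<in> carrier G \<Longrightarrow> \<rho>' g * A = A * \<rho> g"
    and nz: "A \<noteq> 0\<^sub>m m n" and w: "w \<in> carrier_vec m"
  shows "\<exists>v\<in>carrier_vec n. A *\<^sub>v v = w"
proof -
  note rc = rep_carrier[OF r] and rc' = rep_carrier[OF irr_rep[OF r']]
  define W where "W = (\<lambda>v. A *\<^sub>v v) ` carrier_vec n"
  have "W = {0\<^sub>v m} \<or> W = carrier_vec m"
  proof (rule irr_subspace[OF r'])
    show "W \<subseteq> carrier_vec m" using A by (auto simp: W_def)
    have "A *\<^sub>v 0\<^sub>v n = 0\<^sub>v m" using A by (rule mult_mat_zero_vec)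
    then show "0\<^sub>v m \<in> W" unfolding W_def by (metis imageI zero_carrier_vec)
  next
    fix v w assume "v \<in> W" "w \<in> W"
    then obtain v' w' where "v' \<in> carrier_vec n" "w' \<in> carrier_vec n" "v = A *\<^sub>v v'" "w = A *\<^sub>v w'"
      by (auto simp: W_def)
    moreover from this have "v + w = A *\<^sub>v (v' + w')" using A by (simp add: mult_add_distrib_mat_vec)
    ultimately show "v + w \<in> W" unfolding W_def using add_carrier_vec smult_carrier_vec by (metis imageI)
  next
    fix c v assume "v \<in> W"
    then obtain v' where "v' \<in> carrier_vec n" "v = A *\<^sub>v v'" by (auto simp: W_def)
    moreover from this have "c \<cdot>\<^sub>v v = A *\<^sub>v (c \<cdot>\<^sub>v v')" using A by (simp add: mult_mat_vec)
    ultimately show "c \<cdot>\<^sub>v v \<in> W" unfolding W_def using add_carrier_vec smult_carrier_vec by (metis imageI)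
  next
    fix g w assume g: "g \<in> carrier G" and w: "w \<in> W"
    then obtain v where v: "v \<in> carrier_vec n" "w = A *\<^sub>v v" by (auto simp: W_def)
    have "\<rho>' g *\<^sub>v w = (\<rho>' g * A) *\<^sub>v v" using v A rc'[OF g] by simp
    also have "\<dots> = A *\<^sub>v (\<rho> g *\<^sub>v v)" unfolding eq[OF g] using v A rc[OF g] by simp
    finally show "\<rho>' g *\<^sub>v w \<in> W" using rc[OF g] v by (auto simp: W_def)
  qed
  moreover have "W \<noteq> {0\<^sub>v m}"
  proof
    assume 0: "W = {0\<^sub>v m}"
    have "A = 0\<^sub>m m n"
    proof (rule mat_zeroI[OF A])
      fix v :: "complex vec" assume "v \<in> carrier_vec n"
      then have "A *\<^sub>v v \<in> W" by (simp add: W_def)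
      then show "A *\<^sub>v v = 0\<^sub>v m" using 0 by simp
    qed
    with nz show False by simp
  qed
  ultimately have "w \<in> W" using w by blast
  then show ?thesis by (auto simp: W_def)
qed

text \<open>A nonzero intertwiner between irreducible representations is invertible, hence conjugates
  one into the other; the degrees \<open>n\<close> and \<open>m\<close> need not be compared, since the trace is cyclic
  for rectangular factors as well.\<close>

theorem schur_equivalence:
  assumes r: "irreducible_representation G n \<rho>" and r': "irreducible_representation G m \<rho>'"
    and A: "A \<in> carrier_mat m n"
    and eq: "\<And>g. g \<in> carrier G \<Longrightarrow> \<rho>' g * A = A * \<rho> g" and nz: "A \<noteq> 0\<^sub>m m n"
  shows "character_of G \<rho> = character_of G \<rho>'"
proof -
  note rc = rep_carrier[OF irr_rep[OF r]] and rc' = rep_carrier[OF irr_rep[OF r']]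
  have "\<exists>v\<in>carrier_vec n. A *\<^sub>v v = col (1\<^sub>m m) j" if "j < m" for j
    by (rule irr_range[OF irr_rep[OF r] r' A eq nz]) (use that in auto)
  then obtain B where B: "B \<in> carrier_mat n m" "A * B = 1\<^sub>m m"
    using mat_of_solutions[OF A one_carrier_mat] by blast
  have BA: "B * A = 1\<^sub>m n"
  proof (rule mat_col_eqI)
    fix j assume "j < dim_col (1\<^sub>m n)"
    then have j: "j < n" by simp
    let ?c = "col (B * A) j" and ?u = "unit_vec n j"
    have c: "?c \<in> carrier_vec n" using B(1) by (intro carrier_vecI) simp
    have "?c = B *\<^sub>v col A j" by (rule col_mult2[OF B(1) A j])
    then have "A *\<^sub>v ?c = (A * B) *\<^sub>v col A j" using B(1) A j by (simp add: assoc_mult_mat_vec[of A m n B m])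
    also have "\<dots> = col A j" using B A j by simp
    also have "\<dots> = A *\<^sub>v ?u" using mult_mat_unit_vec[OF A j] by simp
    finally have "A *\<^sub>v (?c - ?u) = 0\<^sub>v m"
      using A c by (simp add: mult_minus_distrib_mat_vec[of A m n])
    then have "?c - ?u = 0\<^sub>v n"
      using irr_kernel[OF r irr_rep[OF r'] A eq, of "?c - ?u"] c nz by auto
    then show "?c = col (1\<^sub>m n) j"
      using c j B(1) by (auto simp: vec_eq_iff)
  qed (use B A in auto)
  show ?thesis
  proof
    fix g show "character_of G \<rho> g = character_of G \<rho>' g"
    proof (cases "g \<in> carrier G")
      case g: True
      have "mat_trace (\<rho>' g) = mat_trace (\<rho>' g * (A * B))" using rc'[OF g] B by simp
      also have "\<dots> = mat_trace ((\<rho>' g * A) * B)"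
        using rc'[OF g] A B(1) by (simp add: assoc_mult_mat[of _ m m _ n _ m])
      also have "\<dots> = mat_trace (B * (A * \<rho> g))" unfolding eq[OF g]
        using rc[OF g] A B(1) by (intro mat_trace_mult_comm) auto
      also have "B * (A * \<rho> g) = \<rho> g"
        using rc[OF g] A B(1) BA by (simp add: assoc_mult_mat[of B n m A n _ n, symmetric])
      finally show ?thesis using g by (simp add: character_of_eq)
    qed (simp add: character_of_def)
  qed
qed

theorem schur_scalar:
  assumes r: "irreducible_representation G n \<rho>" and A: "A \<in> carrier_mat n n"
    and eq: "\<And>g. g \<in> carrier G \<Longrightarrow> \<rho> g * A = A * \<rho> g"
  shows "A = (mat_trace A / of_nat n) \<cdot>\<^sub>m 1\<^sub>m n"
proof -
  note rc = rep_carrier[OF irr_rep[OF r]]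
  have n: "n > 0" using rep_degree[OF irr_rep[OF r]] .
  obtain t where "eigenvalue A (t (0::nat))"
    using mat_trace_pow[OF A] n by metis
  then obtain c v where v: "v \<in> carrier_vec n" "v \<noteq> 0\<^sub>v n" "A *\<^sub>v v = c \<cdot>\<^sub>v v"
    using A unfolding eigenvalue_def eigenvector_def by auto
  let ?B = "A - c \<cdot>\<^sub>m 1\<^sub>m n"
  have B: "?B \<in> carrier_mat n n" by (intro minus_carrier_mat) simp
  have "?B *\<^sub>v v = A *\<^sub>v v - (c \<cdot>\<^sub>m 1\<^sub>m n) *\<^sub>v v"
    using A v by (simp add: minus_mult_distrib_mat_vec[of _ n n])
  also have "(c \<cdot>\<^sub>m 1\<^sub>m n) *\<^sub>v v = c \<cdot>\<^sub>v v" using v(1) by (rule scalar_mat_mult_vec)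
  finally have "?B *\<^sub>v v = 0\<^sub>v n" using v by simp
  moreover have "\<rho> g * ?B = ?B * \<rho> g" if g: "g \<in> carrier G" for g
  proof -
    have "\<rho> g * (c \<cdot>\<^sub>m 1\<^sub>m n) = (c \<cdot>\<^sub>m 1\<^sub>m n) * \<rho> g"
      using mult_smult_distrib[OF rc[OF g] one_carrier_mat, of c]
        mult_smult_assoc_mat[OF one_carrier_mat rc[OF g], of c] rc[OF g] by simp
    then show ?thesis
      using mult_minus_distrib_mat[OF rc[OF g] A, of "c \<cdot>\<^sub>m 1\<^sub>m n"]
        minus_mult_distrib_mat[OF A _ rc[OF g], of "c \<cdot>\<^sub>m 1\<^sub>m n"] eq[OF g] by simp
  qed
  ultimately have B0: "?B = 0\<^sub>m n n"
    using irr_kernel[OF r irr_rep[OF r] B] v by blast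
  have Ac: "A = c \<cdot>\<^sub>m 1\<^sub>m n"
  proof (rule eq_matI)
    fix i j assume "i < dim_row (c \<cdot>\<^sub>m 1\<^sub>m n)" "j < dim_col (c \<cdot>\<^sub>m 1\<^sub>m n)"
    then show "A $$ (i, j) = (c \<cdot>\<^sub>m 1\<^sub>m n) $$ (i, j)"
      using arg_cong[OF B0, of "\<lambda>M. M $$ (i, j)"] A by simp
  qed (use A in auto)
  then have "mat_trace A = c * of_nat n" by (simp add: mat_trace_smult[of _ n] mat_trace_one)
  then show ?thesis using Ac n by simp
qed

end

section \<open>Orthogonality of irreducible characters\<close>

text \<open>The \<open>m \<times> n\<close> matrix unit with its only nonzero entry at \<open>(j, k)\<close>.\<close>

definition unit_mat :: "nat \<Rightarrow> nat \<Rightarrow> nat \<Rightarrow> nat \<Rightarrow> complex mat" where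
  "unit_mat m n j k = mat m n (\<lambda>(a, b). if a = j \<and> b = k then 1 else 0)"

lemma unit_mat_carrier [simp]: "unit_mat m n j k \<in> carrier_mat m n"
  by (simp add: unit_mat_def)

lemma index_mult_unit_mat_mult:
  assumes A: "A \<in> carrier_mat r m" and B: "B \<in> carrier_mat n c"
    and "i < r" "j < m" "k < n" "l < c"
  shows "(A * unit_mat m n j k * B) $$ (i, l) = A $$ (i, j) * B $$ (k, l)"
proof -
  have AE: "A * unit_mat m n j k \<in> carrier_mat r n" using A by (metis mult_carrier_mat unit_mat_carrier)
  have *: "(A * unit_mat m n j k) $$ (i, b) = (if b = k then A $$ (i, j) else 0)" if "b < n" for b
  proof -
    have "(A * unit_mat m n j k) $$ (i, b) = (\<Sum>a<m. if a = j then (if b = k then A $$ (i, j) else 0) else 0)"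
      unfolding index_mult_sum[OF A unit_mat_carrier assms(3) that]
      by (intro sum.cong) (use that in \<open>auto simp: unit_mat_def\<close>)
    then show ?thesis using assms(4) by simp
  qed
  have "(A * unit_mat m n j k * B) $$ (i, l) = (\<Sum>b<n. if b = k then A $$ (i, j) * B $$ (k, l) else 0)"
    unfolding index_mult_sum[OF AE B assms(3,6)] by (intro sum.cong) (auto simp: *)
  then show ?thesis using assms(5) by simp
qed

lemma mat_trace_unit_mat: "i < n \<Longrightarrow> k < n \<Longrightarrow> mat_trace (unit_mat n n i k) = (if i = k then 1 else 0)"
proof -
  assume "i < n" "k < n"
  have "mat_trace (unit_mat n n i k) = (\<Sum>a<n. if a = i then (if i = k then 1 else 0) else 0)"
    unfolding mat_trace_eq[OF unit_mat_carrier] by (intro sum.cong) (auto simp: unit_mat_def)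
  then show ?thesis using \<open>i < n\<close> by simp
qed

context fin_group
begin

lemma bij_betw_mult_left: "g \<in> carrier G \<Longrightarrow> bij_betw (\<lambda>x. g \<otimes> x) (carrier G) (carrier G)"
  by (rule bij_betw_byWitness[where f' = "\<lambda>x. inv g \<otimes> x"]) (auto simp: m_assoc[symmetric])

lemma bij_betw_mult_right: "g \<in> carrier G \<Longrightarrow> bij_betw (\<lambda>x. x \<otimes> g) (carrier G) (carrier G)"
  by (rule bij_betw_byWitness[where f' = "\<lambda>x. x \<otimes> inv g"]) (auto simp: m_assoc)

lemma bij_betw_conj:
  assumes g: "g \<in> carrier G"
  shows "bij_betw (\<lambda>x. g \<otimes> x \<otimes> inv g) (carrier G) (carrier G)"
  using bij_betw_trans[OF bij_betw_mult_left[OF g] bij_betw_mult_right[OF inv_closed[OF g]]]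
  by (simp add: o_def)

lemma card_pos: "card (carrier G) > 0"
  using fin by (auto simp: card_gt_0_iff)

text \<open>The average (without the normalising factor \<open>1 / |G|\<close>) of \<open>X\<close> over the group, which is an intertwiner
  from \<open>\<rho>\<close> to \<open>\<rho>'\<close>.\<close>

definition avg :: "('a \<Rightarrow> complex mat) \<Rightarrow> nat \<Rightarrow> ('a \<Rightarrow> complex mat) \<Rightarrow> nat \<Rightarrow> complex mat \<Rightarrow> complex mat" where
  "avg \<rho>' m \<rho> n X = msum m n (\<lambda>x. \<rho>' x * X * \<rho> (inv x)) (carrier G)"

lemma avg_carrier [simp]: "avg \<rho>' m \<rho> n X \<in> carrier_mat m n"
  by (simp add: avg_def)

lemma avg_intertwines:
  assumes r: "representation G n \<rho>" and r': "representation G m \<rho>'" and X: "X \<in> carrier_mat m n"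
    and g: "g \<in> carrier G"
  shows "\<rho>' g * avg \<rho>' m \<rho> n X = avg \<rho>' m \<rho> n X * \<rho> g"
proof -
  note rc = rep_carrier[OF r] and rc' = rep_carrier[OF r']
  have c: "\<rho>' x * X * \<rho> (inv x) \<in> carrier_mat m n" if "x \<in> carrier G" for x
    using rc[OF inv_closed[OF that]] rc'[OF that] X by (metis mult_carrier_mat)
  have "avg \<rho>' m \<rho> n X * \<rho> g = msum m n (\<lambda>x. \<rho>' x * X * \<rho> (inv x) * \<rho> g) (carrier G)"
    unfolding avg_def by (rule msum_mult[OF rc[OF g] c])
  also have "\<dots> = msum m n (\<lambda>x. \<rho>' g * (\<rho>' x * X * \<rho> (inv x))) (carrier G)"
  proof (rule msum_reindex[OF bij_betw_mult_left[OF g]])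
    fix x assume x: "x \<in> carrier G"
    have e: "\<rho> (inv (g \<otimes> x)) * \<rho> g = \<rho> (inv x)"
      using x g rep_mult[OF r, of "inv (g \<otimes> x)" g] by (simp add: inv_mult_group m_assoc)
    have "\<rho>' (g \<otimes> x) * X * \<rho> (inv (g \<otimes> x)) * \<rho> g = \<rho>' (g \<otimes> x) * X * (\<rho> (inv (g \<otimes> x)) * \<rho> g)"
      using rc'[of "g \<otimes> x"] rc[of "inv (g \<otimes> x)"] rc[OF g] X g x
      by (intro assoc_mult_mat[of _ m n _ n _ n]) auto
    also have "\<dots> = \<rho>' g * \<rho>' x * X * \<rho> (inv x)" using e rep_mult[OF r' g x] by simp
    also have "\<dots> = \<rho>' g * (\<rho>' x * X * \<rho> (inv x))"
    proof -
      have 1: "\<rho>' g * \<rho>' x * X = \<rho>' g * (\<rho>' x * X)"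
        using rc'[OF g] rc'[OF x] X by (rule assoc_mult_mat)
      have 2: "\<rho>' x * X \<in> carrier_mat m n" using rc'[OF x] X by simp
      show ?thesis unfolding 1 by (rule assoc_mult_mat[OF rc'[OF g] 2 rc[OF inv_closed[OF x]]])
    qed
    finally show "\<rho>' (g \<otimes> x) * X * \<rho> (inv (g \<otimes> x)) * \<rho> g = \<rho>' g * (\<rho>' x * X * \<rho> (inv x))" .
  qed
  also have "\<dots> = \<rho>' g * avg \<rho>' m \<rho> n X"
    unfolding avg_def by (rule mult_msum[OF rc'[OF g] c, symmetric])
  finally show ?thesis by simp
qed

lemma avg_scalar:
  assumes r: "irreducible_representation G n \<rho>" and X: "X \<in> carrier_mat n n"
  shows "avg \<rho> n \<rho> n X = (of_nat (card (carrier G)) * mat_trace X / of_nat n) \<cdot>\<^sub>m 1\<^sub>m n"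
proof -
  note rr = irr_rep[OF r]
  note rc = rep_carrier[OF rr]
  have "mat_trace (\<rho> x * X * \<rho> (inv x)) = mat_trace X" if x: "x \<in> carrier G" for x
  proof -
    have xx: "inv x \<in> carrier G" using x by simp
    have "mat_trace (\<rho> x * X * \<rho> (inv x)) = mat_trace (\<rho> (inv x) * (\<rho> x * X))"
      using rc[OF x] rc[OF xx] X by (intro mat_trace_mult_comm) auto
    also have "\<rho> (inv x) * (\<rho> x * X) = \<rho> (inv x) * \<rho> x * X"
      using assoc_mult_mat[OF rc[OF xx] rc[OF x] X] by simp
    finally show ?thesis using rep_inv_left[OF rr x] X by simp
  qed
  moreover have "\<rho> x * X * \<rho> (inv x) \<in> carrier_mat n n" if "x \<in> carrier G" for x
    using rc[OF inv_closed[OF that]] rc[OF that] X by (metis mult_carrier_mat)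
  ultimately have "mat_trace (avg \<rho> n \<rho> n X) = of_nat (card (carrier G)) * mat_trace X"
    by (simp add: avg_def mat_trace_msum)
  then show ?thesis
    using schur_scalar[OF r avg_carrier avg_intertwines[OF rr rr X]] by simp
qed

text \<open>Averaging matrix units turns Schur's lemma into orthogonality of matrix coefficients.\<close>

lemma matrix_coefficient_sum:
  assumes "representation G n \<rho>" "representation G m \<rho>'" "i < m" "j < m" "k < n" "l < n"
  shows "(\<Sum>x\<in>carrier G. \<rho>' x $$ (i, j) * \<rho> (inv x) $$ (k, l)) = avg \<rho>' m \<rho> n (unit_mat m n j k) $$ (i, l)"
  unfolding avg_def index_msum[OF assms(3,6)]
  using index_mult_unit_mat_mult[OF rep_carrier[OF assms(2)] rep_carrier[OF assms(1)] assms(3-6)]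
  by (intro sum.cong refl) (simp del: index_mult_mat)

lemma character_sum_expand:
  assumes r: "representation G n \<rho>" and r': "representation G m \<rho>'"
  shows "(\<Sum>x\<in>carrier G. mat_trace (\<rho>' x) * mat_trace (\<rho> (inv x)))
    = (\<Sum>i<m. \<Sum>k<n. avg \<rho>' m \<rho> n (unit_mat m n i k) $$ (i, k))"
proof -
  have "(\<Sum>x\<in>carrier G. mat_trace (\<rho>' x) * mat_trace (\<rho> (inv x)))
      = (\<Sum>x\<in>carrier G. \<Sum>i<m. \<Sum>k<n. \<rho>' x $$ (i, i) * \<rho> (inv x) $$ (k, k))"
    by (intro sum.cong)
      (simp_all add: mat_trace_eq[OF rep_carrier[OF r]] mat_trace_eq[OF rep_carrier[OF r']] sum_product)
  also have "\<dots> = (\<Sum>i<m. \<Sum>k<n. \<Sum>x\<in>carrier G. \<rho>' x $$ (i, i) * \<rho> (inv x) $$ (k, k))"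
    by (subst sum.swap, rule sum.cong[OF refl], subst sum.swap, rule refl)
  finally show ?thesis by (simp add: matrix_coefficient_sum[OF r r'])
qed

theorem character_orthogonality:
  assumes \<chi>: "\<chi> \<in> Irr G" and \<psi>: "\<psi> \<in> Irr G"
  shows "(\<Sum>x\<in>carrier G. \<chi> x * \<psi> (inv x)) = (if \<chi> = \<psi> then of_nat (card (carrier G)) else 0)"
proof -
  obtain m \<rho>' where r': "irreducible_representation G m \<rho>'" and \<chi>_def: "\<chi> = character_of G \<rho>'"
    using \<chi> by (auto simp: Irr_def)
  show ?thesis
  proof (cases "\<chi> = \<psi>")
    case True
    have m: "m > 0" using rep_degree[OF irr_rep[OF r']] .
    have "(\<Sum>x\<in>carrier G. \<chi> x * \<psi> (inv x))
        = (\<Sum>x\<in>carrier G. mat_trace (\<rho>' x) * mat_trace (\<rho>' (inv x)))"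
      unfolding True[symmetric] \<chi>_def by (intro sum.cong refl) (simp add: character_of_eq)
    also have "\<dots> = (\<Sum>i<m. \<Sum>k<m. if k = i then of_nat (card (carrier G)) / of_nat m else 0)"
      unfolding character_sum_expand[OF irr_rep[OF r'] irr_rep[OF r']]
      by (intro sum.cong refl) (simp add: avg_scalar[OF r'] mat_trace_unit_mat)
    finally show ?thesis using True m by simp
  next
    case False
    obtain n \<rho> where r: "irreducible_representation G n \<rho>" and \<psi>_def: "\<psi> = character_of G \<rho>"
      using \<psi> by (auto simp: Irr_def)
    have "avg \<rho>' m \<rho> n X = 0\<^sub>m m n" if X: "X \<in> carrier_mat m n" for X
      using schur_equivalence[OF r r' avg_carrier avg_intertwines[OF irr_rep[OF r] irr_rep[OF r'] X]]
        False \<chi>_def \<psi>_def by metis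
    then have "(\<Sum>x\<in>carrier G. mat_trace (\<rho>' x) * mat_trace (\<rho> (inv x))) = 0"
      unfolding character_sum_expand[OF irr_rep[OF r] irr_rep[OF r']] by simp
    then show ?thesis using False \<chi>_def \<psi>_def by (simp add: character_of_eq)
  qed
qed

lemma conjugate_sum_scalar:
  assumes r: "irreducible_representation G n \<rho>" and h: "h \<in> carrier G"
  shows "msum n n (\<lambda>x. \<rho> (x \<otimes> h \<otimes> inv x)) (carrier G)
    = (of_nat (card (carrier G)) * mat_trace (\<rho> h) / of_nat n) \<cdot>\<^sub>m 1\<^sub>m n"
proof -
  note rr = irr_rep[OF r]
  have "msum n n (\<lambda>x. \<rho> (x \<otimes> h \<otimes> inv x)) (carrier G) = avg \<rho> n \<rho> n (\<rho> h)"
    unfolding avg_def by (rule msum_cong) (simp add: h rep_mult[OF rr])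
  then show ?thesis using avg_scalar[OF r rep_carrier[OF rr h]] by simp
qed

text \<open>The value at \<open>\<rho>\<close> of the Fourier transform of a function \<open>f\<close> on the group, taken
  with \<open>\<rho> (x\<inverse>)\<close>. It commutes with intertwiners, and is itself an intertwiner when \<open>f\<close> is a
  class function.\<close>

definition fourier :: "('a \<Rightarrow> complex mat) \<Rightarrow> nat \<Rightarrow> ('a \<Rightarrow> complex) \<Rightarrow> complex mat" where
  "fourier \<rho> n f = msum n n (\<lambda>x. f x \<cdot>\<^sub>m \<rho> (inv x)) (carrier G)"

lemma fourier_carrier [simp]: "fourier \<rho> n f \<in> carrier_mat n n"
  by (simp add: fourier_def)

lemma fourier_intertwines:
  assumes r: "representation G n \<rho>" and r': "representation G m \<rho>'"
    and A: "A \<in> carrier_mat m n" and eq: "\<And>g. g \<in> carrier G \<Longrightarrow> \<rho>' g * A = A * \<rho> g"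
  shows "fourier \<rho>' m f * A = A * fourier \<rho> n f"
proof -
  note rc = rep_carrier[OF r] and rc' = rep_carrier[OF r']
  have "fourier \<rho>' m f * A = msum m n (\<lambda>x. f x \<cdot>\<^sub>m \<rho>' (inv x) * A) (carrier G)"
    unfolding fourier_def using rc' by (intro msum_mult A) auto
  also have "\<dots> = msum m n (\<lambda>x. A * (f x \<cdot>\<^sub>m \<rho> (inv x))) (carrier G)"
  proof (rule msum_cong)
    fix x assume "x \<in> carrier G"
    then have x: "inv x \<in> carrier G" by simp
    show "f x \<cdot>\<^sub>m \<rho>' (inv x) * A = A * (f x \<cdot>\<^sub>m \<rho> (inv x))"
      using mult_smult_assoc_mat[OF rc'[OF x] A, of "f x"] mult_smult_distrib[OF A rc[OF x], of "f x"]
        eq[OF x] by simp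
  qed
  also have "\<dots> = A * fourier \<rho> n f"
    unfolding fourier_def using rc by (intro mult_msum[symmetric] A) auto
  finally show ?thesis .
qed

lemma fourier_central:
  assumes r: "representation G n \<rho>" and g: "g \<in> carrier G"
    and f: "\<And>x. x \<in> carrier G \<Longrightarrow> f (g \<otimes> x \<otimes> inv g) = f x"
  shows "\<rho> g * fourier \<rho> n f = fourier \<rho> n f * \<rho> g"
proof -
  note rc = rep_carrier[OF r]
  have "fourier \<rho> n f * \<rho> g = msum n n (\<lambda>x. f x \<cdot>\<^sub>m \<rho> (inv x) * \<rho> g) (carrier G)"
    unfolding fourier_def using rc by (intro msum_mult rc g) auto
  also have "\<dots> = msum n n (\<lambda>x. \<rho> g * (f x \<cdot>\<^sub>m \<rho> (inv x))) (carrier G)"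
  proof (rule msum_reindex[OF bij_betw_conj[OF g]])
    fix x assume x: "x \<in> carrier G"
    let ?y = "g \<otimes> x \<otimes> inv g"
    have y: "inv ?y \<in> carrier G" and xi: "inv x \<in> carrier G" using g x by auto
    have "inv ?y \<otimes> g = g \<otimes> inv x"
      using g x by (simp add: inv_mult_group m_assoc)
    then have e: "\<rho> (inv ?y) * \<rho> g = \<rho> g * \<rho> (inv x)"
      using rep_mult[OF r y g] rep_mult[OF r g xi] by simp
    show "f ?y \<cdot>\<^sub>m \<rho> (inv ?y) * \<rho> g = \<rho> g * (f x \<cdot>\<^sub>m \<rho> (inv x))"
      unfolding f[OF x] mult_smult_assoc_mat[OF rc[OF y] rc[OF g]] mult_smult_distrib[OF rc[OF g] rc[OF xi]] e ..
  qed
  also have "\<dots> = \<rho> g * fourier \<rho> n f"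
    unfolding fourier_def using rc by (intro mult_msum[symmetric] rc g) auto
  finally show ?thesis by simp
qed

lemma fourier_scalar:
  assumes r: "irreducible_representation G n \<rho>"
    and f: "\<And>g x. g \<in> carrier G \<Longrightarrow> x \<in> carrier G \<Longrightarrow> f (g \<otimes> x \<otimes> inv g) = f x"
  shows "fourier \<rho> n f = ((\<Sum>x\<in>carrier G. f x * mat_trace (\<rho> (inv x))) / of_nat n) \<cdot>\<^sub>m 1\<^sub>m n"
proof -
  note rc = rep_carrier[OF irr_rep[OF r]]
  have "mat_trace (fourier \<rho> n f) = (\<Sum>x\<in>carrier G. f x * mat_trace (\<rho> (inv x)))"
    unfolding fourier_def using rc by (subst mat_trace_msum) (auto simp: mat_trace_smult[of _ n] intro!: sum.cong)
  moreover have "\<rho> g * fourier \<rho> n f = fourier \<rho> n f * \<rho> g" if "g \<in> carrier G" for g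
    by (rule fourier_central[OF irr_rep[OF r] that]) (simp add: f that)
  ultimately show ?thesis using schur_scalar[OF r fourier_carrier[of \<rho> n f]] by metis
qed

lemma rep_pow:
  assumes r: "representation G n \<rho>" and g: "g \<in> carrier G"
  shows "\<rho> (g [^] (k::nat)) = \<rho> g ^\<^sub>m k"
proof (induction k)
  case 0
  then show ?case using rep_one[OF r] rep_carrier[OF r g] by simp
next
  case (Suc k)
  then show ?case using rep_mult[OF r _ g, of "g [^] k"] g by simp
qed

text \<open>The matrix \<open>\<rho> g\<close> has finite order, so its eigenvalues are roots of unity; their inverses are
  their conjugates.\<close>

lemma mat_trace_rep_inv:
  assumes r: "representation G n \<rho>" and g: "g \<in> carrier G"
  shows "mat_trace (\<rho> (inv g)) = cnj (mat_trace (\<rho> g))"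
proof -
  note A = rep_carrier[OF r g]
  obtain t where t: "\<And>k. mat_trace (\<rho> g ^\<^sub>m k) = (\<Sum>i<n. t i ^ k)"
    and ev: "\<And>i. i < n \<Longrightarrow> eigenvalue (\<rho> g) (t i)" using mat_trace_pow[OF A] by blast
  \<comment> \<open>The inverse of \<open>g\<close> is its power with exponent \<open>|G| - 1\<close>.\<close>
  define N where "N = card (carrier G) - 1"
  have N: "card (carrier G) = Suc N" using card_pos by (simp add: N_def)
  have gN: "g [^] Suc N = \<one>" using pow_order_eq_1[OF g] N by (simp add: Coset.order_def)
  have inv: "inv g = g [^] N"
    using gN g by (intro inv_equality) simp_all
  have "cnj (t i) = t i ^ N" if i: "i < n" for i
  proof -
    obtain v where v: "eigenvector (\<rho> g) v (t i)" using ev[OF i] by (auto simp: eigenvalue_def)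
    then have vc: "v \<in> carrier_vec n" "v \<noteq> 0\<^sub>v n" using A by (auto simp: eigenvector_def)
    have "\<rho> g ^\<^sub>m Suc N *\<^sub>v v = t i ^ Suc N \<cdot>\<^sub>v v" by (rule eigenvector_pow[OF A v])
    moreover have "\<rho> g ^\<^sub>m Suc N = 1\<^sub>m n" using rep_pow[OF r g, of "Suc N"] gN rep_one[OF r] by metis
    ultimately have eq: "v = t i ^ Suc N \<cdot>\<^sub>v v" using vc by simp
    obtain l where l: "l < n" "v $ l \<noteq> 0"
      using vc by (metis carrier_vecD eq_vecI index_zero_vec)
    have t1: "t i ^ Suc N = 1" using arg_cong[OF eq, of "\<lambda>v. v $ l"] l vc by simp
    then have "norm (t i) ^ Suc N = 1" by (metis norm_one norm_power)
    then have "norm (t i) = 1" by (metis norm_ge_zero power_eq_1_iff zero_less_Suc nat.distinct(1) abs_norm_cancel real_norm_def)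
    then have "t i * cnj (t i) = 1" using complex_norm_square[of "t i"] by simp
    then have "cnj (t i) = t i ^ Suc N * cnj (t i)" using t1 by simp
    also have "\<dots> = t i ^ N * (t i * cnj (t i))" by simp
    finally show ?thesis using \<open>t i * cnj (t i) = 1\<close> by simp
  qed
  then have "(\<Sum>i<n. t i ^ N) = cnj (\<Sum>i<n. t i)" by simp
  then show ?thesis using t[of 1] t[of N] A inv rep_pow[OF r g, of N] by simp
qed

end

section \<open>Subspaces and subrepresentations\<close>

lemma index_mult_vec_sum:
  assumes "A \<in> carrier_mat m n" "v \<in> carrier_vec n" "i < m"
  shows "(A *\<^sub>v v) $ i = (\<Sum>j<n. A $$ (i, j) * v $ j)"
  using assms by (auto simp: scalar_prod_def atLeast0LessThan)

text \<open>An \<open>n \<times> k\<close> matrix that is injective on column vectors: a basis, listed by columns, of its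
  range.\<close>

definition inj_mat :: "nat \<Rightarrow> nat \<Rightarrow> complex mat \<Rightarrow> bool" where
  "inj_mat n k B \<longleftrightarrow> B \<in> carrier_mat n k \<and> (\<forall>v\<in>carrier_vec k. B *\<^sub>v v = 0\<^sub>v n \<longrightarrow> v = 0\<^sub>v k)"

lemma inj_mat_carrier: "inj_mat n k B \<Longrightarrow> B \<in> carrier_mat n k"
  by (simp add: inj_mat_def)

lemma inj_mat_zero: "inj_mat n k B \<Longrightarrow> v \<in> carrier_vec k \<Longrightarrow> B *\<^sub>v v = 0\<^sub>v n \<Longrightarrow> v = 0\<^sub>v k"
  by (simp add: inj_mat_def)

text \<open>Otherwise the square matrix padded with zero rows is singular, and a vector in its kernel
  contradicts injectivity.\<close>

lemma inj_mat_le: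
  assumes B: "inj_mat n k B" shows "k \<le> n"
proof (rule ccontr)
  assume "\<not> k \<le> n"
  then have nk: "n < k" by simp
  note Bc = inj_mat_carrier[OF B]
  define C where "C = mat k k (\<lambda>(i, j). if i < n then B $$ (i, j) else 0)"
  have C: "C \<in> carrier_mat k k" by (simp add: C_def)
  have "transpose_mat C *\<^sub>v unit_vec k (k - 1) = 0\<^sub>v k"
    using nk C by (subst mult_mat_unit_vec[of _ k k]) (auto simp: C_def intro!: eq_vecI)
  moreover have "unit_vec k (k - 1) \<noteq> (0\<^sub>v k :: complex vec)"
    using nk by (metis diff_less gr_zeroI index_unit_vec(1) index_zero_vec(1) less_zeroE one_neq_zero zero_less_one)
  ultimately have "det (transpose_mat C) = 0"
    using det_0_iff_vec_prod_zero_field[of "transpose_mat C" k] C by (metis transpose_carrier_mat unit_vec_carrier)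
  then have "det C = 0" using det_transpose[OF C] by simp
  then obtain v where v: "v \<in> carrier_vec k" "v \<noteq> 0\<^sub>v k" "C *\<^sub>v v = 0\<^sub>v k"
    using det_0_iff_vec_prod_zero_field[OF C] by blast
  have "B *\<^sub>v v = 0\<^sub>v n"
  proof (rule eq_vecI)
    fix i assume "i < dim_vec (0\<^sub>v n :: complex vec)"
    then have i: "i < n" by simp
    then have ik: "i < k" using nk by simp
    have "(C *\<^sub>v v) $ i = (B *\<^sub>v v) $ i"
      unfolding index_mult_vec_sum[OF C v(1) ik] index_mult_vec_sum[OF Bc v(1) i]
      by (intro sum.cong) (use i ik in \<open>auto simp: C_def\<close>)
    then show "(B *\<^sub>v v) $ i = 0\<^sub>v n $ i" using v(3) i ik by simp
  qed (use Bc in auto)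
  then show False using inj_mat_zero[OF B v(1)] v(2) by simp
qed

lemma inj_mat_mult:
  assumes A: "inj_mat n m A" and B: "inj_mat m k B"
  shows "inj_mat n k (A * B)"
  unfolding inj_mat_def
proof (intro conjI ballI impI)
  note Ac = inj_mat_carrier[OF A] and Bc = inj_mat_carrier[OF B]
  show "A * B \<in> carrier_mat n k" using Ac Bc by simp
  fix v :: "complex vec" assume v: "v \<in> carrier_vec k" and "A * B *\<^sub>v v = 0\<^sub>v n"
  then have "A *\<^sub>v (B *\<^sub>v v) = 0\<^sub>v n" using assoc_mult_mat_vec[OF Ac Bc v] by simp
  then have "B *\<^sub>v v = 0\<^sub>v m" using inj_mat_zero[OF A] Bc v by simp
  then show "v = 0\<^sub>v k" using inj_mat_zero[OF B v] by simp
qed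

lemma inj_mat_cancel:
  assumes B: "inj_mat n k B" and T: "T \<in> carrier_mat k m" "T' \<in> carrier_mat k m" and eq: "B * T = B * T'"
  shows "T = T'"
proof -
  note Bc = inj_mat_carrier[OF B]
  have "T - T' = 0\<^sub>m k m"
  proof (rule mat_zeroI)
    fix v :: "complex vec" assume v: "v \<in> carrier_vec m"
    have "B *\<^sub>v ((T - T') *\<^sub>v v) = B * (T - T') *\<^sub>v v"
      using assoc_mult_mat_vec[OF Bc minus_carrier_mat[OF T(2)] v] by simp
    also have "B * (T - T') = 0\<^sub>m n m"
      unfolding mult_minus_distrib_mat[OF Bc T] eq using Bc T by (intro minus_r_inv_mat) simp
    finally have "B *\<^sub>v ((T - T') *\<^sub>v v) = 0\<^sub>v n" using v by (auto intro!: eq_vecI)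
    then show "(T - T') *\<^sub>v v = 0\<^sub>v k" 
      using mult_mat_vec_carrier[OF minus_carrier_mat[OF T(2)] v] inj_mat_zero[OF B] by blast
  qed (use T in auto)
  then show ?thesis
    using T by (intro eq_matI) (metis T carrier_matD index_minus_mat(1) index_zero_mat(1) right_minus_eq, auto)
qed

text \<open>The \<open>n \<times> k\<close> matrix \<open>B\<close> with \<open>w\<close> appended as last column.\<close>

definition append_col :: "nat \<Rightarrow> nat \<Rightarrow> complex mat \<Rightarrow> complex vec \<Rightarrow> complex mat" where
  "append_col n k B w = mat n (Suc k) (\<lambda>(i, j). if j < k then B $$ (i, j) else w $ i)"

lemma append_col_carrier [simp]: "append_col n k B w \<in> carrier_mat n (Suc k)"
  by (simp add: append_col_def)

lemma append_col_mult:
  assumes B: "B \<in> carrier_mat n k" and w: "w \<in> carrier_vec n" and v: "v \<in> carrier_vec (Suc k)"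
  shows "append_col n k B w *\<^sub>v v = B *\<^sub>v vec k (\<lambda>j. v $ j) + v $ k \<cdot>\<^sub>v w"
proof (rule eq_vecI)
  let ?u = "vec k (\<lambda>j. v $ j)"
  fix i assume "i < dim_vec (B *\<^sub>v ?u + v $ k \<cdot>\<^sub>v w)"
  then have i: "i < n" using w by simp
  have u: "?u \<in> carrier_vec k" by simp
  have "(append_col n k B w *\<^sub>v v) $ i = (\<Sum>j<k. B $$ (i, j) * v $ j) + v $ k * w $ i"
    unfolding index_mult_vec_sum[OF append_col_carrier v i] using i by (simp add: append_col_def)
  also have "(\<Sum>j<k. B $$ (i, j) * v $ j) = (B *\<^sub>v ?u) $ i"
    unfolding index_mult_vec_sum[OF B u i] by simp
  finally show "(append_col n k B w *\<^sub>v v) $ i = (B *\<^sub>v ?u + v $ k \<cdot>\<^sub>v w) $ i"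
    using i w B by (simp del: index_mult_mat_vec)
qed (use B w in \<open>auto simp: append_col_def\<close>)

lemma append_col_range:
  assumes B: "inj_mat n k B" and w: "w \<in> carrier_vec n" and ninj: "\<not> inj_mat n (Suc k) (append_col n k B w)"
  shows "\<exists>u\<in>carrier_vec k. B *\<^sub>v u = w"
proof -
  note Bc = inj_mat_carrier[OF B]
  obtain v where v: "v \<in> carrier_vec (Suc k)" "v \<noteq> 0\<^sub>v (Suc k)" "append_col n k B w *\<^sub>v v = 0\<^sub>v n"
    using ninj by (auto simp: inj_mat_def)
  define u where "u = vec k (\<lambda>j. v $ j)"
  have u: "u \<in> carrier_vec k" by (simp add: u_def)
  have eq: "B *\<^sub>v u + v $ k \<cdot>\<^sub>v w = 0\<^sub>v n"
    using append_col_mult[OF Bc w v(1)] v(3) by (simp add: u_def)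
  have eqi: "(B *\<^sub>v u) $ i + v $ k * w $ i = 0" if "i < n" for i
    using arg_cong[OF eq, of "\<lambda>v. v $ i"] that w by (simp del: index_mult_mat_vec)
  have vk: "v $ k \<noteq> 0"
  proof
    assume 0: "v $ k = 0"
    then have "B *\<^sub>v u = 0\<^sub>v n"
      using eqi Bc by (intro eq_vecI) (auto simp del: index_mult_mat_vec)
    then have "u = 0\<^sub>v k" using inj_mat_zero[OF B u] by simp
    then have "v $ j = 0" if "j < k" for j
    proof -
      have "v $ j = u $ j" using that by (simp add: u_def)
      then show ?thesis using \<open>u = 0\<^sub>v k\<close> that by simp
    qed
    then have "v = 0\<^sub>v (Suc k)" using 0 v(1) by (intro eq_vecI) (auto simp: less_Suc_eq)
    with v(2) show False by simp
  qed
  have "B *\<^sub>v ((- 1 / v $ k) \<cdot>\<^sub>v u) = w"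
  proof (rule eq_vecI)
    fix i assume "i < dim_vec w"
    then have i: "i < n" using w by simp
    have "(B *\<^sub>v ((- 1 / v $ k) \<cdot>\<^sub>v u)) $ i = (- 1 / v $ k) * (B *\<^sub>v u) $ i"
      using i Bc by (simp add: mult_mat_vec[OF Bc u] del: index_mult_mat_vec)
    also have "(B *\<^sub>v u) $ i = - (v $ k * w $ i)" using eqi[OF i] by (simp add: eq_neg_iff_add_eq_0)
    finally show "(B *\<^sub>v ((- 1 / v $ k) \<cdot>\<^sub>v u)) $ i = w $ i" using vk by simp
  qed (use Bc w in auto)
  then show ?thesis using u by (metis smult_carrier_vec)
qed

text \<open>An injective matrix with range inside \<open>W\<close> and the largest possible number of columns has
  range \<open>W\<close>.\<close>

lemma subspace_basis:
  assumes W: "is_subspace n W"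
  obtains k B where "inj_mat n k B" "W = (\<lambda>v. B *\<^sub>v v) ` carrier_vec k"
proof -
  define P where "P k \<longleftrightarrow> (\<exists>B. inj_mat n k B \<and> (\<forall>v\<in>carrier_vec k. B *\<^sub>v v \<in> W))" for k
  have "inj_mat n 0 (0\<^sub>m n 0)" by (auto simp: inj_mat_def)
  moreover have "0\<^sub>m n 0 *\<^sub>v v = 0\<^sub>v n" if "v \<in> carrier_vec 0" for v :: "complex vec"
    using that by (intro eq_vecI) (auto simp: scalar_prod_def)
  ultimately have "P 0" using W unfolding P_def is_subspace_iff by metis
  moreover have "k \<le> n" if "P k" for k using that inj_mat_le by (auto simp: P_def)
  ultimately obtain k where k: "P k" and max: "\<And>k'. P k' \<Longrightarrow> k' \<le> k"
    using GreatestI_nat[of P 0 n] Greatest_le_nat[of P _ n] by blast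
  obtain B where B: "inj_mat n k B" and BW: "\<And>v. v \<in> carrier_vec k \<Longrightarrow> B *\<^sub>v v \<in> W"
    using k by (auto simp: P_def)
  note Bc = inj_mat_carrier[OF B]
  have "\<exists>u\<in>carrier_vec k. B *\<^sub>v u = w" if w: "w \<in> W" for w
  proof (rule append_col_range[OF B])
    show wc: "w \<in> carrier_vec n" using w W by (auto simp: is_subspace_iff)
    have "append_col n k B w *\<^sub>v v \<in> W" if v: "v \<in> carrier_vec (Suc k)" for v
    proof -
      have "B *\<^sub>v vec k (\<lambda>j. v $ j) \<in> W" by (rule BW) simp
      moreover have "v $ k \<cdot>\<^sub>v w \<in> W" using w W by (simp add: is_subspace_iff)
      ultimately show ?thesis unfolding append_col_mult[OF Bc wc v] using W by (simp add: is_subspace_iff)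
    qed
    then show "\<not> inj_mat n (Suc k) (append_col n k B w)"
      using max[of "Suc k"] by (auto simp: P_def)
  qed
  then have "W = (\<lambda>v. B *\<^sub>v v) ` carrier_vec k" using BW by auto
  with B show ?thesis by (rule that)
qed

context fin_group
begin

text \<open>The group maps the set \<open>W\<close> of vectors into itself.\<close>

definition invariant :: "('a \<Rightarrow> complex mat) \<Rightarrow> complex vec set \<Rightarrow> bool" where
  "invariant \<rho> W \<longleftrightarrow> (\<forall>g\<in>carrier G. \<forall>w\<in>W. \<rho> g *\<^sub>v w \<in> W)"

text \<open>In a basis of an invariant subspace the action is again given by matrices; the degree drops
  unless the subspace is everything.\<close>

lemma subrepresentation:
  assumes r: "representation G n \<rho>" and W: "is_subspace n W" and inv: "invariant \<rho> W" and nz: "W \<noteq> {0\<^sub>v n}"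
  obtains k B \<tau> where "inj_mat n k B" "W = (\<lambda>v. B *\<^sub>v v) ` carrier_vec k" "representation G k \<tau>"
    "\<And>g. g \<in> carrier G \<Longrightarrow> \<rho> g * B = B * \<tau> g" "W \<noteq> carrier_vec n \<Longrightarrow> k < n"
proof -
  note rc = rep_carrier[OF r]
  obtain k B where B: "inj_mat n k B" and WB: "W = (\<lambda>v. B *\<^sub>v v) ` carrier_vec k"
    using subspace_basis[OF W] by blast
  note Bc = inj_mat_carrier[OF B]
  have "\<exists>T. T \<in> carrier_mat k k \<and> B * T = \<rho> g * B" if g: "g \<in> carrier G" for g
  proof -
    have C: "\<rho> g * B \<in> carrier_mat n k" using rc[OF g] Bc by simp
    have "\<exists>v\<in>carrier_vec k. B *\<^sub>v v = col (\<rho> g * B) j" if j: "j < k" for j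
    proof -
      have "B *\<^sub>v unit_vec k j \<in> W" by (auto simp: WB)
      then have "\<rho> g *\<^sub>v (B *\<^sub>v unit_vec k j) \<in> W" using inv g by (simp add: invariant_def)
      then have "col (\<rho> g * B) j \<in> W"
        unfolding col_mult2[OF rc[OF g] Bc j] mult_mat_unit_vec[OF Bc j] .
      then show ?thesis by (auto simp: WB)
    qed
    then show ?thesis using mat_of_solutions[OF Bc C] by metis
  qed
  then obtain \<tau> where tc: "\<And>g. g \<in> carrier G \<Longrightarrow> \<tau> g \<in> carrier_mat k k"
    and eq: "\<And>g. g \<in> carrier G \<Longrightarrow> B * \<tau> g = \<rho> g * B" by metis
  have k: "k > 0"
  proof (rule ccontr)
    assume "\<not> k > 0"
    then have "v = 0\<^sub>v k" if "v \<in> carrier_vec k" for v :: "complex vec" using that by (intro eq_vecI) auto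
    then have "W \<subseteq> {0\<^sub>v n}" using mult_mat_zero_vec[OF Bc] by (force simp: WB)
    then show False using nz W by (auto simp: is_subspace_iff)
  qed
  have "representation G k \<tau>"
  proof (rule representationI[OF k tc])
    fix g h assume g: "g \<in> carrier G" and h: "h \<in> carrier G"
    have "B * \<tau> (g \<otimes> h) = \<rho> g * \<rho> h * B" using eq[of "g \<otimes> h"] rep_mult[OF r g h] g h by simp
    also have "\<dots> = \<rho> g * (B * \<tau> h)" unfolding eq[OF h] by (rule assoc_mult_mat[OF rc[OF g] rc[OF h] Bc])
    also have "\<dots> = B * \<tau> g * \<tau> h" unfolding eq[OF g] using assoc_mult_mat[OF rc[OF g] Bc tc[OF h]] by simp
    also have "\<dots> = B * (\<tau> g * \<tau> h)" by (rule assoc_mult_mat[OF Bc tc[OF g] tc[OF h]])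
    finally show "\<tau> (g \<otimes> h) = \<tau> g * \<tau> h"
      using inj_mat_cancel[OF B tc[of "g \<otimes> h"] mult_carrier_mat[OF tc[OF g] tc[OF h]]] g h by simp
  next
    have "B * \<tau> \<one> = B * 1\<^sub>m k" using eq[of \<one>] rep_one[OF r] Bc by simp
    then show "\<tau> \<one> = 1\<^sub>m k" using inj_mat_cancel[OF B tc[of \<one>] one_carrier_mat] by simp
  qed
  moreover have "k < n" if "W \<noteq> carrier_vec n"
  proof (rule ccontr)
    assume "\<not> k < n"
    then have kn: "k = n" using inj_mat_le[OF B] by simp
    have "\<exists>u\<in>carrier_vec k. B *\<^sub>v u = w" if "w \<in> carrier_vec n" for w
      using append_col_range[OF B that] inj_mat_le[of n "Suc k"] kn by auto
    then have "carrier_vec n \<subseteq> W" by (force simp: WB)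
    with that W show False by (auto simp: is_subspace_iff)
  qed
  ultimately show ?thesis using that[OF B WB] eq by metis
qed

text \<open>A subrepresentation of least degree inside \<open>W\<close> is irreducible.\<close>

lemma irreducible_subrepresentation:
  assumes r: "representation G n \<rho>" and W: "is_subspace n W" and inv: "invariant \<rho> W" and nz: "W \<noteq> {0\<^sub>v n}"
  obtains m A \<sigma> where "irreducible_representation G m \<sigma>" "inj_mat n m A"
    "\<And>v. v \<in> carrier_vec m \<Longrightarrow> A *\<^sub>v v \<in> W" "\<And>g. g \<in> carrier G \<Longrightarrow> \<rho> g * A = A * \<sigma> g"
proof -
  define P where "P m \<longleftrightarrow> (\<exists>A \<sigma>. representation G m \<sigma> \<and> inj_mat n m A \<and>
    (\<forall>v\<in>carrier_vec m. A *\<^sub>v v \<in> W) \<and> (\<forall>g\<in>carrier G. \<rho> g * A = A * \<sigma> g))" for m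
  have "\<exists>m. P m"
    using subrepresentation[OF r W inv nz] unfolding P_def by (metis imageI)
  then obtain m where m: "P m" and min: "\<And>k. k < m \<Longrightarrow> \<not> P k"
    using exists_least_iff[of P] by blast
  obtain A \<sigma> where s: "representation G m \<sigma>" and A: "inj_mat n m A"
    and AW: "\<And>v. v \<in> carrier_vec m \<Longrightarrow> A *\<^sub>v v \<in> W" and eq: "\<And>g. g \<in> carrier G \<Longrightarrow> \<rho> g * A = A * \<sigma> g"
    using m by (auto simp: P_def)
  note Ac = inj_mat_carrier[OF A]
  have "irreducible_representation G m \<sigma>"
    unfolding irreducible_representation_def
  proof (intro conjI allI impI s)
    fix U assume "is_subspace m U \<and> (\<forall>g\<in>carrier G. \<forall>w\<in>U. \<sigma> g *\<^sub>v w \<in> U)"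
    then have U: "is_subspace m U" "invariant \<sigma> U" by (auto simp: invariant_def)
    show "U = {0\<^sub>v m} \<or> U = carrier_vec m"
    proof (rule ccontr)
      assume neg: "\<not> ?thesis"
      obtain k B \<tau> where B: "inj_mat m k B" and t: "representation G k \<tau>"
        and eqB: "\<And>g. g \<in> carrier G \<Longrightarrow> \<sigma> g * B = B * \<tau> g" and km: "k < m"
        using subrepresentation[OF s U] neg by metis
      note Bc = inj_mat_carrier[OF B]
      have "A * B *\<^sub>v v \<in> W" if v: "v \<in> carrier_vec k" for v
        using AW[of "B *\<^sub>v v"] assoc_mult_mat_vec[OF Ac Bc v] Bc v by simp
      moreover have "\<rho> g * (A * B) = A * B * \<tau> g" if g: "g \<in> carrier G" for g
      proof -
        note gc = rep_carrier[OF r g] rep_carrier[OF s g] rep_carrier[OF t g]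
        have "\<rho> g * (A * B) = A * \<sigma> g * B"
          using assoc_mult_mat[OF gc(1) Ac Bc] eq[OF g] by simp
        also have "\<dots> = A * (B * \<tau> g)" using assoc_mult_mat[OF Ac gc(2) Bc] eqB[OF g] by simp
        also have "\<dots> = A * B * \<tau> g" using assoc_mult_mat[OF Ac Bc gc(3)] by simp
        finally show ?thesis .
      qed
      ultimately have "P k" unfolding P_def using t inj_mat_mult[OF A B] by metis
      then show False using min[OF km] by simp
    qed
  qed
  then show ?thesis using that A AW eq by blast
qed

section \<open>The regular representation\<close>

text \<open>The left regular representation, with coordinates numbered by an enumeration \<open>e\<close> of the
  group.\<close>

definition regular :: "(nat \<Rightarrow> 'a) \<Rightarrow> 'a \<Rightarrow> complex mat" where
  "regular e g = mat (card (carrier G)) (card (carrier G)) (\<lambda>(i, j). if e i = g \<otimes> e j then 1 else 0)"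

lemma regular_carrier [simp]: "regular e g \<in> carrier_mat (card (carrier G)) (card (carrier G))"
  by (simp add: regular_def)

lemma ex_enumeration: obtains e where "bij_betw e {..<card (carrier G)} (carrier G)"
  using ex_bij_betw_nat_finite[OF fin] by (auto simp: atLeast0LessThan)

lemma regular_representation:
  assumes e: "bij_betw e {..<card (carrier G)} (carrier G)"
  shows "representation G (card (carrier G)) (regular e)"
proof (rule representationI[OF card_pos regular_carrier])
  let ?N = "card (carrier G)"
  have ec: "e i \<in> carrier G" if "i < ?N" for i using e that by (auto simp: bij_betw_def)
  have inj: "e i = e j \<longleftrightarrow> i = j" if "i < ?N" "j < ?N" for i j
    using e that by (auto simp: bij_betw_def inj_on_def)
  show "regular e \<one> = 1\<^sub>m ?N"
    by (rule eq_matI) (auto simp: regular_def ec inj)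
  fix g h assume g: "g \<in> carrier G" and h: "h \<in> carrier G"
  show "regular e (g \<otimes> h) = regular e g * regular e h"
  proof (rule eq_matI)
    fix i j assume "i < dim_row (regular e g * regular e h)" "j < dim_col (regular e g * regular e h)"
    then have i: "i < ?N" and j: "j < ?N" by (auto simp: regular_def)
    have "h \<otimes> e j \<in> e ` {..<?N}" using e h ec[OF j] by (simp add: bij_betw_def)
    then obtain l where l: "l < ?N" "e l = h \<otimes> e j" by auto
    have "(regular e g * regular e h) $$ (i, j) = (\<Sum>a<?N. if a = l then (if e i = g \<otimes> e l then 1 else 0) else 0)"
      unfolding index_mult_sum[OF regular_carrier regular_carrier i j]
    proof (intro sum.cong refl)
      fix a assume "a \<in> {..<?N}"
      then have a: "a < ?N" by simp
      have "e a = h \<otimes> e j \<longleftrightarrow> a = l" using inj[OF a l(1)] l(2) by simp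
      then show "regular e g $$ (i, a) * regular e h $$ (a, j)
          = (if a = l then (if e i = g \<otimes> e l then 1 else 0) else 0)"
        using a i j by (simp add: regular_def)
    qed
    also have "\<dots> = (if e i = g \<otimes> e l then 1 else 0)" using l by simp
    finally show "regular e (g \<otimes> h) $$ (i, j) = (regular e g * regular e h) $$ (i, j)"
      using i j l g h ec[OF j] by (simp add: regular_def m_assoc)
  qed (auto simp: regular_def)
qed

lemma index_fourier_regular:
  assumes e: "bij_betw e {..<card (carrier G)} (carrier G)"
    and i: "i < card (carrier G)" and j: "j < card (carrier G)"
  shows "fourier (regular e) (card (carrier G)) f $$ (i, j) = f (e j \<otimes> inv (e i))"
proof -
  have ec: "e i \<in> carrier G" "e j \<in> carrier G" using e i j by (auto simp: bij_betw_def)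
  have "fourier (regular e) (card (carrier G)) f $$ (i, j)
      = (\<Sum>x\<in>carrier G. if x = e j \<otimes> inv (e i) then f (e j \<otimes> inv (e i)) else 0)"
    unfolding fourier_def index_msum[OF i j]
  proof (rule sum.cong[OF refl])
    fix x assume x: "x \<in> carrier G"
    have "e i = inv x \<otimes> e j \<longleftrightarrow> x = e j \<otimes> inv (e i)"
      using x ec by (metis inv_closed inv_solve_left inv_solve_right)
    then show "(f x \<cdot>\<^sub>m regular e (inv x)) $$ (i, j) = (if x = e j \<otimes> inv (e i) then f (e j \<otimes> inv (e i)) else 0)"
      using i j by (auto simp: regular_def)
  qed
  then show ?thesis using fin ec by simp
qed

text \<open>Completeness of the irreducible representations for class functions. On the regular
  representation the Fourier transform \<open>Z\<close> of \<open>f\<close> is a Hermitian matrix commuting with the group. If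
  \<open>Z\<close> were nonzero, its range would contain an irreducible subrepresentation, on which \<open>Z\<close> vanishes
  by hypothesis; but the range and the kernel of a Hermitian matrix meet only in zero. This argument
  does not need complete reducibility. The entries of \<open>Z\<close> are the values of \<open>f\<close>.\<close>

theorem class_function_eq_zero:
  assumes cf: "\<And>g x. g \<in> carrier G \<Longrightarrow> x \<in> carrier G \<Longrightarrow> f (g \<otimes> x \<otimes> inv g) = f x"
    and herm: "\<And>x. x \<in> carrier G \<Longrightarrow> f (inv x) = cnj (f x)"
    and irr0: "\<And>n \<rho>. irreducible_representation G n \<rho> \<Longrightarrow> fourier \<rho> n f = 0\<^sub>m n n"
    and x: "x \<in> carrier G"
  shows "f x = 0"
proof -
  define N where "N = card (carrier G)"
  obtain e where e: "bij_betw e {..<N} (carrier G)" using ex_enumeration N_def by metis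
  have ec: "e i \<in> carrier G" if "i < N" for i using e that by (auto simp: bij_betw_def)
  define R where "R = regular e"
  have R: "representation G N R" unfolding N_def R_def by (rule regular_representation) (use e N_def in simp)
  note Rc = rep_carrier[OF R]
  define Z where "Z = fourier R N f"
  have Z: "Z \<in> carrier_mat N N" by (simp add: Z_def)
  have Zi: "Z $$ (i, j) = f (e j \<otimes> inv (e i))" if "i < N" "j < N" for i j
    using that e unfolding Z_def R_def N_def by (intro index_fourier_regular) auto
  have Zh: "Z $$ (j, i) = cnj (Z $$ (i, j))" if "i < N" "j < N" for i j
    using herm[of "e j \<otimes> inv (e i)"] that ec by (simp add: Zi inv_mult_group)
  have Zc: "R g * Z = Z * R g" if "g \<in> carrier G" for g
    unfolding Z_def by (rule fourier_central[OF R that]) (simp add: cf that)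
  have "Z = 0\<^sub>m N N"
  proof (rule ccontr)
    assume nz: "Z \<noteq> 0\<^sub>m N N"
    define W where "W = (\<lambda>v. Z *\<^sub>v v) ` carrier_vec N"
    have "is_subspace N W"
      unfolding is_subspace_iff
    proof (intro conjI ballI allI)
      show "W \<subseteq> carrier_vec N" using Z by (auto simp: W_def)
      show "0\<^sub>v N \<in> W" unfolding W_def by (rule image_eqI[of _ _ "0\<^sub>v N"]) (simp_all add: mult_mat_zero_vec[OF Z])
      fix v w assume "v \<in> W" "w \<in> W"
      then obtain v' w' where *: "v' \<in> carrier_vec N" "w' \<in> carrier_vec N" "v = Z *\<^sub>v v'" "w = Z *\<^sub>v w'"
        by (auto simp: W_def)
      show "v + w \<in> W" unfolding W_def
        by (rule image_eqI[of _ _ "v' + w'"]) (use * mult_add_distrib_mat_vec[OF Z *(1,2)] in auto)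
    next
      fix c v assume "v \<in> W"
      then obtain v' where *: "v' \<in> carrier_vec N" "v = Z *\<^sub>v v'" by (auto simp: W_def)
      show "c \<cdot>\<^sub>v v \<in> W" unfolding W_def
        by (rule image_eqI[of _ _ "c \<cdot>\<^sub>v v'"]) (use * mult_mat_vec[OF Z *(1)] in auto)
    qed
    moreover have "invariant R W"
      unfolding invariant_def
    proof (intro ballI)
      fix g w assume g: "g \<in> carrier G" and "w \<in> W"
      then obtain v where v: "v \<in> carrier_vec N" "w = Z *\<^sub>v v" by (auto simp: W_def)
      have "R g *\<^sub>v w = Z *\<^sub>v (R g *\<^sub>v v)"
        using assoc_mult_mat_vec[OF Rc[OF g] Z v(1)] assoc_mult_mat_vec[OF Z Rc[OF g] v(1)] Zc[OF g] v(2) by simp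
      then show "R g *\<^sub>v w \<in> W" using Rc[OF g] v(1) by (auto simp: W_def)
    qed
    moreover have "W \<noteq> {0\<^sub>v N}"
    proof
      assume 0: "W = {0\<^sub>v N}"
      have "Z *\<^sub>v v = 0\<^sub>v N" if "v \<in> carrier_vec N" for v
      proof -
        have "Z *\<^sub>v v \<in> W" using that by (simp add: W_def)
        then show ?thesis using 0 by simp
      qed
      then show False using mat_zeroI[OF Z] nz by blast
    qed
    ultimately obtain m A \<sigma> where s: "irreducible_representation G m \<sigma>" and A: "inj_mat N m A"
      and AW: "\<And>v. v \<in> carrier_vec m \<Longrightarrow> A *\<^sub>v v \<in> W" and eq: "\<And>g. g \<in> carrier G \<Longrightarrow> R g * A = A * \<sigma> g"
      using irreducible_subrepresentation[OF R] by metis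
    note Ac = inj_mat_carrier[OF A]
    have m: "m > 0" using rep_degree[OF irr_rep[OF s]] .
    have ZA: "Z * A = 0\<^sub>m N m"
      using fourier_intertwines[OF irr_rep[OF s] R Ac eq] irr0[OF s] Ac by (simp add: Z_def)
    define a where "a = A *\<^sub>v unit_vec m 0"
    have ac: "a \<in> carrier_vec N" using Ac by (simp add: a_def)
    have a0: "a \<noteq> 0\<^sub>v N"
    proof
      assume "a = 0\<^sub>v N"
      then have "unit_vec m 0 = (0\<^sub>v m :: complex vec)"
        using inj_mat_zero[OF A, of "unit_vec m 0"] by (simp add: a_def)
      then show False using m by (metis index_unit_vec(1) index_zero_vec(1) one_neq_zero)
    qed
    have Za: "Z *\<^sub>v a = 0\<^sub>v N"
    proof -
      have "Z *\<^sub>v a = 0\<^sub>m N m *\<^sub>v unit_vec m 0"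
        using assoc_mult_mat_vec[OF Z Ac, of "unit_vec m 0"] ZA by (simp add: a_def)
      then show ?thesis by (auto intro!: eq_vecI)
    qed
    obtain u where u: "u \<in> carrier_vec N" "a = Z *\<^sub>v u"
      using AW[of "unit_vec m 0"] by (auto simp: a_def W_def)
    \<comment> \<open>The vector \<open>a = Z u\<close> lies in the kernel of \<open>Z\<close>, so \<open>\<langle>a, Z u\<rangle> = \<langle>Z a, u\<rangle> = 0\<close>.\<close>
    have "(\<Sum>i<N. a $ i * cnj (a $ i)) = (\<Sum>i<N. \<Sum>j<N. a $ i * cnj (Z $$ (i, j)) * cnj (u $ j))"
      unfolding u(2) by (intro sum.cong refl)
        (simp add: index_mult_vec_sum[OF Z u(1)] sum_distrib_left mult.assoc del: index_mult_mat_vec)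
    also have "\<dots> = (\<Sum>j<N. (\<Sum>i<N. Z $$ (j, i) * a $ i) * cnj (u $ j))"
    proof (subst sum.swap, intro sum.cong refl)
      fix j assume j: "j \<in> {..<N}"
      show "(\<Sum>i<N. a $ i * cnj (Z $$ (i, j)) * cnj (u $ j)) = (\<Sum>i<N. Z $$ (j, i) * a $ i) * cnj (u $ j)"
        unfolding sum_distrib_right
      proof (intro sum.cong refl)
        fix i assume i: "i \<in> {..<N}"
        show "a $ i * cnj (Z $$ (i, j)) * cnj (u $ j) = Z $$ (j, i) * a $ i * cnj (u $ j)"
          using Zh[of i j] i j by (simp only: lessThan_iff mult.commute)
      qed
    qed
    also have "\<dots> = (\<Sum>j<N. (Z *\<^sub>v a) $ j * cnj (u $ j))"
      by (intro sum.cong refl) (simp add: index_mult_vec_sum[OF Z ac] del: index_mult_mat_vec)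
    also have "\<dots> = 0" unfolding Za by simp
    finally have "(\<Sum>i<N. complex_of_real ((norm (a $ i))\<^sup>2)) = 0"
      by (simp add: complex_norm_square del: of_real_power)
    then have "(\<Sum>i<N. (norm (a $ i))\<^sup>2) = 0"
      by (metis of_real_sum of_real_eq_0_iff)
    then have "\<forall>i<N. a $ i = 0" by (subst (asm) sum_nonneg_eq_0_iff) auto
    then have "a = 0\<^sub>v N" using ac by (intro eq_vecI) auto
    with a0 show False by simp
  qed
  have "\<one> \<in> e ` {..<N}" "x \<in> e ` {..<N}" using e x by (simp_all add: bij_betw_def)
  then obtain i j where ij: "i < N" "e i = \<one>" "j < N" "e j = x" by auto
  then have "f x = Z $$ (i, j)" using x by (simp add: Zi)
  then show ?thesis using \<open>Z = 0\<^sub>m N N\<close> ij by simp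
qed

section \<open>The regular character\<close>

lemma IrrE:
  assumes "\<chi> \<in> Irr G"
  obtains n \<rho> where "irreducible_representation G n \<rho>" "\<chi> = character_of G \<rho>" "n > 0" "\<chi> \<one> = of_nat n"
    "\<And>g. g \<in> carrier G \<Longrightarrow> \<chi> g = mat_trace (\<rho> g)"
proof -
  obtain n \<rho> where *: "irreducible_representation G n \<rho>" "\<chi> = character_of G \<rho>"
    using assms by (auto simp: Irr_def)
  show ?thesis
    by (rule that[OF *]) (use * rep_degree irr_rep character_of_one character_of_eq in auto)
qed

lemma Irr_one_nonzero: "\<chi> \<in> Irr G \<Longrightarrow> \<chi> \<one> \<noteq> 0"
  by (elim IrrE) simp

lemma Irr_inv: "\<chi> \<in> Irr G \<Longrightarrow> g \<in> carrier G \<Longrightarrow> \<chi> (inv g) = cnj (\<chi> g)"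
  by (elim IrrE) (simp add: mat_trace_rep_inv[OF irr_rep])

lemma Irr_mult_comm:
  assumes "\<chi> \<in> Irr G" and g: "g \<in> carrier G" and h: "h \<in> carrier G"
  shows "\<chi> (g \<otimes> h) = \<chi> (h \<otimes> g)"
proof -
  obtain n \<rho> where r: "irreducible_representation G n \<rho>" and \<chi>: "\<And>g. g \<in> carrier G \<Longrightarrow> \<chi> g = mat_trace (\<rho> g)"
    using assms(1) by (elim IrrE) blast
  note rr = irr_rep[OF r]
  show ?thesis
    using mat_trace_mult_comm[OF rep_carrier[OF rr g] rep_carrier[OF rr h]] g h
    by (simp add: \<chi> rep_mult[OF rr])
qed

lemma Irr_conj:
  assumes "\<chi> \<in> Irr G" and g: "g \<in> carrier G" and x: "x \<in> carrier G"
  shows "\<chi> (g \<otimes> x \<otimes> inv g) = \<chi> x"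
  using Irr_mult_comm[OF assms(1), of "g \<otimes> x" "inv g"] g x by (simp add: m_assoc[symmetric])

text \<open>The difference between \<open>|G|\<close> times the indicator of the identity and the part of the regular
  character that is supported on a set of irreducible characters. For a finite set it is orthogonal to
  the members of the set.\<close>

definition defect :: "('a \<Rightarrow> complex) set \<Rightarrow> 'a \<Rightarrow> complex" where
  "defect S x = (if x = \<one> then of_nat (card (carrier G)) else 0) - (\<Sum>\<chi>\<in>S. \<chi> \<one> * \<chi> x)"

lemma sum_indicator_one:
  "(\<Sum>x\<in>carrier G. (if x = \<one> then c else 0) * F x) = c * (F \<one> :: complex)"
proof -
  have "(\<Sum>x\<in>carrier G. (if x = \<one> then c else 0) * F x) = (\<Sum>x\<in>carrier G. if x = \<one> then c * F \<one> else 0)"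
    by (intro sum.cong) auto
  then show ?thesis using fin by simp
qed

lemma defect_orthogonal:
  assumes S: "finite S" "S \<subseteq> Irr G" and \<psi>: "\<psi> \<in> S"
  shows "(\<Sum>x\<in>carrier G. defect S x * \<psi> (inv x)) = 0"
proof -
  let ?N = "of_nat (card (carrier G)) :: complex"
  have "(\<Sum>x\<in>carrier G. (\<Sum>\<chi>\<in>S. \<chi> \<one> * \<chi> x) * \<psi> (inv x))
      = (\<Sum>\<chi>\<in>S. \<chi> \<one> * (\<Sum>x\<in>carrier G. \<chi> x * \<psi> (inv x)))"
    unfolding sum_distrib_right sum_distrib_left by (subst sum.swap) (simp add: mult.assoc)
  also have "\<dots> = (\<Sum>\<chi>\<in>S. if \<chi> = \<psi> then \<psi> \<one> * ?N else 0)"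
    by (intro sum.cong refl) (use S \<psi> in \<open>auto simp: character_orthogonality subset_iff\<close>)
  also have "\<dots> = \<psi> \<one> * ?N" using S \<psi> by simp
  finally show ?thesis
    using sum_indicator_one[of ?N "\<lambda>x. \<psi> (inv x)"]
    by (simp add: defect_def left_diff_distrib sum_subtractf)
qed

lemma defect_inv:
  assumes "S \<subseteq> Irr G" and x: "x \<in> carrier G"
  shows "defect S (inv x) = cnj (defect S x)"
proof -
  have "inv x = \<one> \<longleftrightarrow> x = \<one>" using x by (metis inv_inv inv_one)
  moreover have "(\<Sum>\<chi>\<in>S. \<chi> \<one> * \<chi> (inv x)) = (\<Sum>\<chi>\<in>S. cnj (\<chi> \<one> * \<chi> x))"
  proof (intro sum.cong refl)
    fix \<chi> assume "\<chi> \<in> S"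
    then have \<chi>: "\<chi> \<in> Irr G" using assms(1) by blast
    show "\<chi> \<one> * \<chi> (inv x) = cnj (\<chi> \<one> * \<chi> x)"
      using Irr_inv[OF \<chi> x] Irr_inv[OF \<chi> one_closed] by simp
  qed
  ultimately show ?thesis by (simp add: defect_def)
qed

text \<open>Bessel's inequality for the indicator of the identity: the squared norm of
  \<^const>\<open>defect\<close> is \<open>|G|\<close> times its value at the identity, and that value is at most
  \<open>|G| - |S|\<close> because every degree is at least 1.\<close>

theorem finite_Irr: "finite (Irr G)"
proof (rule ccontr)
  assume "infinite (Irr G)"
  then obtain S where S: "finite S" "S \<subseteq> Irr G" and cS: "card S = Suc (card (carrier G))"
    using infinite_arbitrarily_large by blast
  let ?N = "card (carrier G)"
  have "(\<Sum>x\<in>carrier G. defect S x * defect S (inv x)) = of_nat ?N * defect S \<one>"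
  proof -
    have "(\<Sum>x\<in>carrier G. defect S x * defect S (inv x))
        = (\<Sum>x\<in>carrier G. (if x = \<one> then of_nat ?N else 0) * defect S x
            - (\<Sum>\<psi>\<in>S. \<psi> \<one> * (defect S x * \<psi> (inv x))))"
    proof (intro sum.cong refl)
      fix x assume "x \<in> carrier G"
      then have "inv x = \<one> \<longleftrightarrow> x = \<one>" by (metis inv_inv inv_one)
      then show "defect S x * defect S (inv x)
        = (if x = \<one> then of_nat ?N else 0) * defect S x - (\<Sum>\<psi>\<in>S. \<psi> \<one> * (defect S x * \<psi> (inv x)))"
        unfolding defect_def[of S "inv x"] right_diff_distrib sum_distrib_left by (simp add: mult_ac)
    qed
    also have "\<dots> = of_nat ?N * defect S \<one> - (\<Sum>\<psi>\<in>S. \<psi> \<one> * (\<Sum>x\<in>carrier G. defect S x * \<psi> (inv x)))"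
      unfolding sum_subtractf sum_indicator_one sum_distrib_left by (subst sum.swap) (rule refl)
    also have "\<dots> = of_nat ?N * defect S \<one>" using defect_orthogonal[OF S] by simp
    finally show ?thesis .
  qed
  moreover have "(\<Sum>x\<in>carrier G. defect S x * defect S (inv x)) = of_real (\<Sum>x\<in>carrier G. (norm (defect S x))\<^sup>2)"
    by (simp add: defect_inv[OF S(2)] complex_norm_square[symmetric] del: of_real_power)
  ultimately have "of_nat ?N * defect S \<one> = of_real (\<Sum>x\<in>carrier G. (norm (defect S x))\<^sup>2)" by metis
  then have "Re (of_nat ?N * defect S \<one>) = (\<Sum>x\<in>carrier G. (norm (defect S x))\<^sup>2)"
    by (simp only: Re_complex_of_real)
  then have "Re (of_nat ?N * defect S \<one>) \<ge> 0" by (simp only: sum_nonneg zero_le_power2)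
  then have "Re (defect S \<one>) \<ge> 0" using card_pos by (simp add: zero_le_mult_iff)
  moreover have "Re (\<chi> \<one> * \<chi> \<one>) \<ge> 1" if \<chi>: "\<chi> \<in> S" for \<chi>
  proof -
    have "\<chi> \<in> Irr G" using \<chi> S by blast
    then obtain n where n: "n > 0" "\<chi> \<one> = of_nat n" by (elim IrrE) blast
    then have "1 \<le> n * n" by simp
    then have "1 \<le> real (n * n)" by linarith
    then show ?thesis using n by simp
  qed
  then have "(\<Sum>\<chi>\<in>S. 1) \<le> (\<Sum>\<chi>\<in>S. Re (\<chi> \<one> * \<chi> \<one>))" by (rule sum_mono)
  ultimately show False using cS by (simp add: defect_def)
qed

theorem regular_character:
  assumes x: "x \<in> carrier G"
  shows "(\<Sum>\<chi>\<in>Irr G. \<chi> \<one> * \<chi> x) = (if x = \<one> then of_nat (card (carrier G)) else 0)"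
proof -
  have cf: "defect (Irr G) (g \<otimes> x \<otimes> inv g) = defect (Irr G) x" if "g \<in> carrier G" "x \<in> carrier G" for g x
  proof -
    have "g \<otimes> x \<otimes> inv g = \<one> \<longleftrightarrow> g \<otimes> x = g"
      using inv_solve_right'[of \<one> "g \<otimes> x" g] that by auto
    also have "\<dots> \<longleftrightarrow> x = \<one>" using that by simp
    finally have "g \<otimes> x \<otimes> inv g = \<one> \<longleftrightarrow> x = \<one>" .
    then show ?thesis using that by (simp add: defect_def Irr_conj)
  qed
  have "defect (Irr G) x = 0"
  proof (rule class_function_eq_zero[OF cf _ _ x])
    fix y assume "y \<in> carrier G"
    then show "defect (Irr G) (inv y) = cnj (defect (Irr G) y)" by (rule defect_inv[OF subset_refl])
  next
    fix n \<rho> assume r: "irreducible_representation G n \<rho>"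
    have "character_of G \<rho> \<in> Irr G" using r by (auto simp: Irr_def)
    from defect_orthogonal[OF finite_Irr subset_refl this]
    have "(\<Sum>x\<in>carrier G. defect (Irr G) x * mat_trace (\<rho> (inv x))) = 0"
      by (simp add: character_of_eq)
    then show "fourier \<rho> n (defect (Irr G)) = 0\<^sub>m n n"
      using fourier_scalar[OF r cf] by (auto intro!: eq_matI)
  qed
  then show ?thesis by (simp add: defect_def)
qed

text \<open>The conjugates of \<open>k\<close> add up to a scalar on the representation, which factors out of the
  character.\<close>

lemma Irr_conj_sum:
  assumes \<chi>: "\<chi> \<in> Irr G" and k: "k \<in> carrier G" and g: "g \<in> carrier G"
  shows "(\<Sum>x\<in>carrier G. \<chi> (x \<otimes> k \<otimes> inv x \<otimes> g)) = of_nat (card (carrier G)) * \<chi> k / \<chi> \<one> * \<chi> g"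
proof -
  obtain n \<rho> where r: "irreducible_representation G n \<rho>" and n: "\<chi> \<one> = of_nat n"
    and tr: "\<And>g. g \<in> carrier G \<Longrightarrow> \<chi> g = mat_trace (\<rho> g)" using \<chi> by (elim IrrE) blast
  note rr = irr_rep[OF r]
  note rc = rep_carrier[OF rr]
  let ?c = "of_nat (card (carrier G)) * mat_trace (\<rho> k) / of_nat n"
  have c: "x \<otimes> k \<otimes> inv x \<in> carrier G" if "x \<in> carrier G" for x using that k by simp
  have "(\<Sum>x\<in>carrier G. \<chi> (x \<otimes> k \<otimes> inv x \<otimes> g)) = (\<Sum>x\<in>carrier G. mat_trace (\<rho> (x \<otimes> k \<otimes> inv x) * \<rho> g))"
    using c g by (intro sum.cong refl) (simp add: tr rep_mult[OF rr])
  also have "\<dots> = mat_trace (msum n n (\<lambda>x. \<rho> (x \<otimes> k \<otimes> inv x) * \<rho> g) (carrier G))"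
    by (rule mat_trace_msum[symmetric]) (rule mult_carrier_mat[OF rc[OF c] rc[OF g]])
  also have "\<dots> = mat_trace (msum n n (\<lambda>x. \<rho> (x \<otimes> k \<otimes> inv x)) (carrier G) * \<rho> g)"
    by (subst msum_mult[OF rc[OF g]]) (simp_all add: rc[OF c])
  also have "\<dots> = mat_trace (?c \<cdot>\<^sub>m \<rho> g)"
    unfolding conjugate_sum_scalar[OF r k]
    using mult_smult_assoc_mat[OF one_carrier_mat rc[OF g], of ?c] rc[OF g] by simp
  also have "\<dots> = ?c * mat_trace (\<rho> g)" by (rule mat_trace_smult[OF rc[OF g]])
  finally show ?thesis by (simp add: tr k g n)
qed

section \<open>Degrees divide the group order\<close>

text \<open>If a sum of group elements with nonnegative integer multiplicities acts as a scalar on some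
  representation, that scalar is an algebraic integer: the matrix of left multiplication on the group
  ring has integer entries, and the function \<open>x \<mapsto> \<rho> (x\<inverse>)\<^sub>0\<^sub>0\<close> is an eigenvector of it.\<close>

lemma group_ring_scalar_algebraic_int:
  assumes r: "representation G n \<rho>" and P: "finite P" "\<And>p. p \<in> P \<Longrightarrow> w p \<in> carrier G"
    and c: "msum n n (\<lambda>p. \<rho> (w p)) P = c \<cdot>\<^sub>m 1\<^sub>m n"
  shows "algebraic_int c"
proof -
  note rc = rep_carrier[OF r]
  have n: "n > 0" using rep_degree[OF r] .
  define N where "N = card (carrier G)"
  obtain e where e: "bij_betw e {..<N} (carrier G)" using ex_enumeration N_def by metis
  have ec: "e i \<in> carrier G" if "i < N" for i using e that by (auto simp: bij_betw_def)
  define M where "M = mat N N (\<lambda>(i, j). int (card {p \<in> P. e i = w p \<otimes> e j}))"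
  have M: "M \<in> carrier_mat N N" by (simp add: M_def)
  have M': "map_mat of_int M \<in> carrier_mat N N" using M by simp
  define v where "v = vec N (\<lambda>j. \<rho> (inv (e j)) $$ (0, 0))"
  have v: "v \<in> carrier_vec N" by (simp add: v_def)
  have "map_mat of_int M *\<^sub>v v = c \<cdot>\<^sub>v v"
  proof (rule eq_vecI)
    fix i assume "i < dim_vec (c \<cdot>\<^sub>v v)"
    then have i: "i < N" by (simp add: v_def)
    let ?x = "inv (e i)"
    have x: "?x \<in> carrier G" using ec[OF i] by simp
    have count: "complex_of_int (M $$ (i, j)) = (\<Sum>p\<in>P. if e i = w p \<otimes> e j then 1 else 0)" if "j < N" for j
      using i that P(1) by (simp add: M_def sum.If_cases Collect_conj_eq[symmetric] Int_def)
    have "(map_mat of_int M *\<^sub>v v) $ i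
        = (\<Sum>j<N. \<Sum>p\<in>P. if e i = w p \<otimes> e j then \<rho> (inv (e j)) $$ (0, 0) else 0)"
      unfolding index_mult_vec_sum[OF M' v i]
    proof (intro sum.cong refl)
      fix j assume "j \<in> {..<N}"
      then have j: "j < N" by simp
      have "map_mat of_int M $$ (i, j) = complex_of_int (M $$ (i, j))" using M i j by simp
      moreover have "v $ j = \<rho> (inv (e j)) $$ (0, 0)" using j by (simp add: v_def)
      ultimately show "map_mat of_int M $$ (i, j) * v $ j
          = (\<Sum>p\<in>P. if e i = w p \<otimes> e j then \<rho> (inv (e j)) $$ (0, 0) else 0)"
        by (simp only: count[OF j] sum_distrib_right) (intro sum.cong refl, simp)
    qed
    also have "\<dots> = (\<Sum>p\<in>P. \<Sum>j<N. if e i = w p \<otimes> e j then \<rho> (inv (e j)) $$ (0, 0) else 0)"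
      by (rule sum.swap)
    also have "\<dots> = (\<Sum>p\<in>P. (\<rho> ?x * \<rho> (w p)) $$ (0, 0))"
    proof (intro sum.cong refl)
      fix p assume p: "p \<in> P"
      have "(\<Sum>j<N. if e i = w p \<otimes> e j then \<rho> (inv (e j)) $$ (0, 0) else 0)
          = (\<Sum>y\<in>carrier G. if e i = w p \<otimes> y then \<rho> (inv y) $$ (0, 0) else 0)"
        by (rule sum.reindex_bij_betw[OF e])
      also have "\<dots> = (\<Sum>y\<in>carrier G. if y = inv (w p) \<otimes> e i then (\<rho> ?x * \<rho> (w p)) $$ (0, 0) else 0)"
      proof (intro sum.cong refl)
        fix y assume y: "y \<in> carrier G"
        have "e i = w p \<otimes> y \<longleftrightarrow> y = inv (w p) \<otimes> e i"
          using y P(2)[OF p] ec[OF i] by (metis inv_closed inv_solve_left)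
        moreover have "\<rho> (inv (inv (w p) \<otimes> e i)) = \<rho> ?x * \<rho> (w p)"
          using P(2)[OF p] ec[OF i] rep_mult[OF r x P(2)[OF p]] by (simp add: inv_mult_group)
        ultimately show "(if e i = w p \<otimes> y then \<rho> (inv y) $$ (0, 0) else 0)
            = (if y = inv (w p) \<otimes> e i then (\<rho> ?x * \<rho> (w p)) $$ (0, 0) else 0)" by metis
      qed
      also have "\<dots> = (\<rho> ?x * \<rho> (w p)) $$ (0, 0)" using fin P(2)[OF p] ec[OF i] by simp
      finally show "(\<Sum>j<N. if e i = w p \<otimes> e j then \<rho> (inv (e j)) $$ (0, 0) else 0)
          = (\<rho> ?x * \<rho> (w p)) $$ (0, 0)" .
    qed
    also have "\<dots> = (\<rho> ?x * msum n n (\<lambda>p. \<rho> (w p)) P) $$ (0, 0)"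
      using mult_msum[OF rc[OF x], of P "\<lambda>p. \<rho> (w p)" n] rc P(2) n by (simp add: index_msum)
    also have "\<rho> ?x * msum n n (\<lambda>p. \<rho> (w p)) P = c \<cdot>\<^sub>m \<rho> ?x"
      unfolding c using mult_smult_distrib[OF rc[OF x] one_carrier_mat, of c] rc[OF x] by simp
    also have "(c \<cdot>\<^sub>m \<rho> ?x) $$ (0, 0) = (c \<cdot>\<^sub>v v) $ i"
      using rc[OF x] n i by (simp add: v_def)
    finally show "(map_mat of_int M *\<^sub>v v) $ i = (c \<cdot>\<^sub>v v) $ i" .
  qed (use M in \<open>auto simp: v_def\<close>)
  moreover have "v \<noteq> 0\<^sub>v N"
  proof -
    have "\<one> \<in> e ` {..<N}" using e by (simp add: bij_betw_def)
    then obtain i where i: "i < N" "e i = \<one>" by auto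
    then have "v $ i = 1" using rep_one[OF r] n by (simp add: v_def)
    then show ?thesis using i by auto
  qed
  ultimately have "eigenvalue (map_mat of_int M) c"
    using v M' unfolding eigenvalue_def eigenvector_def by auto
  then show ?thesis using eigenvalue_int_mat_algebraic_int[OF M] by simp
qed

text \<open>The sum of all commutators acts on an irreducible representation of degree \<open>n\<close> as the scalar
  \<open>(|G| / n)\<^sup>2\<close>. Hence \<open>|G| / n\<close> is a rational algebraic integer. This avoids showing
  that character values are algebraic integers.\<close>

theorem degree_dvd_order:
  assumes r: "irreducible_representation G n \<rho>"
  shows "n dvd card (carrier G)"
proof -
  note rr = irr_rep[OF r]
  note rc = rep_carrier[OF rr]
  have n: "n > 0" using rep_degree[OF rr] .
  let ?N = "card (carrier G)"
  let ?q = "of_nat ?N / of_nat n :: complex"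
  define \<chi> where "\<chi> = character_of G \<rho>"
  have \<chi>: "\<chi> \<in> Irr G" using r by (auto simp: Irr_def \<chi>_def)
  have tr: "\<chi> g = mat_trace (\<rho> g)" if "g \<in> carrier G" for g using that by (simp add: \<chi>_def character_of_eq)
  define w where "w = (\<lambda>(y, x). x \<otimes> y \<otimes> inv x \<otimes> inv y)"
  \<comment> \<open>Summing over \<open>x\<close> first replaces each conjugacy class by a scalar.\<close>
  have "msum n n (\<lambda>p. \<rho> (w p)) (carrier G \<times> carrier G) = fourier \<rho> n (\<lambda>y. ?q * \<chi> y)"
  proof (rule eq_matI)
    fix i j assume "i < dim_row (fourier \<rho> n (\<lambda>y. ?q * \<chi> y))" "j < dim_col (fourier \<rho> n (\<lambda>y. ?q * \<chi> y))"
    then have ij: "i < n" "j < n" by (auto simp: fourier_def msum_def)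
    have "(\<Sum>x\<in>carrier G. \<rho> (x \<otimes> y \<otimes> inv x \<otimes> inv y) $$ (i, j)) = ((?q * \<chi> y) \<cdot>\<^sub>m \<rho> (inv y)) $$ (i, j)"
      if y: "y \<in> carrier G" for y
    proof -
      have yi: "inv y \<in> carrier G" using y by simp
      have c: "x \<otimes> y \<otimes> inv x \<in> carrier G" if "x \<in> carrier G" for x using that y by simp
      have "(\<Sum>x\<in>carrier G. \<rho> (x \<otimes> y \<otimes> inv x \<otimes> inv y) $$ (i, j))
          = msum n n (\<lambda>x. \<rho> (x \<otimes> y \<otimes> inv x) * \<rho> (inv y)) (carrier G) $$ (i, j)"
        unfolding index_msum[OF ij] by (intro sum.cong refl) (simp only: rep_mult[OF rr c yi])
      also have "msum n n (\<lambda>x. \<rho> (x \<otimes> y \<otimes> inv x) * \<rho> (inv y)) (carrier G)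
          = msum n n (\<lambda>x. \<rho> (x \<otimes> y \<otimes> inv x)) (carrier G) * \<rho> (inv y)"
        by (rule msum_mult[OF rc[OF yi], symmetric]) (rule rc[OF c])
      also have "\<dots> = (?q * \<chi> y) \<cdot>\<^sub>m \<rho> (inv y)"
        unfolding conjugate_sum_scalar[OF r y]
        using mult_smult_assoc_mat[OF one_carrier_mat rc[OF yi], of "?q * \<chi> y"] rc[OF yi] tr[OF y] by simp
      finally show ?thesis .
    qed
    moreover have "(\<Sum>p\<in>carrier G \<times> carrier G. \<rho> (w p) $$ (i, j))
        = (\<Sum>y\<in>carrier G. \<Sum>x\<in>carrier G. \<rho> (x \<otimes> y \<otimes> inv x \<otimes> inv y) $$ (i, j))"
      unfolding sum.cartesian_product by (intro sum.cong) (auto simp: w_def)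
    ultimately show "msum n n (\<lambda>p. \<rho> (w p)) (carrier G \<times> carrier G) $$ (i, j) = fourier \<rho> n (\<lambda>y. ?q * \<chi> y) $$ (i, j)"
      unfolding fourier_def index_msum[OF ij] by simp
  qed (auto simp: fourier_def msum_def)
  also have "\<dots> = (?q ^ 2) \<cdot>\<^sub>m 1\<^sub>m n"
  proof -
    have "(\<Sum>y\<in>carrier G. ?q * \<chi> y * mat_trace (\<rho> (inv y))) = ?q * (\<Sum>y\<in>carrier G. \<chi> y * \<chi> (inv y))"
      by (simp add: sum_distrib_left tr mult.assoc)
    then have *: "(\<Sum>y\<in>carrier G. ?q * \<chi> y * mat_trace (\<rho> (inv y))) / of_nat n = ?q ^ 2"
      by (simp add: character_orthogonality[OF \<chi> \<chi>] power2_eq_square)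
    show ?thesis
      using fourier_scalar[OF r, of "\<lambda>y. ?q * \<chi> y"] Irr_conj[OF \<chi>] unfolding * by simp
  qed
  finally have "msum n n (\<lambda>p. \<rho> (w p)) (carrier G \<times> carrier G) = (?q ^ 2) \<cdot>\<^sub>m 1\<^sub>m n" .
  then have "algebraic_int (?q ^ 2)"
    using group_ring_scalar_algebraic_int[OF rr, of "carrier G \<times> carrier G" w] fin by (auto simp: w_def)
  then have "algebraic_int ?q"
    by (rule algebraic_int_root[where p = "Polynomial.monom 1 2"]) (auto simp: poly_monom degree_monom_eq coeff_monom)
  moreover have "?q \<in> \<rat>" by (intro Rats_divide Rats_of_nat)
  ultimately have "?q \<in> \<int>" by (rule rational_algebraic_int_is_int)
  then obtain k where "?q = of_int k" by (auto elim: Ints_cases)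
  then have "complex_of_int (int ?N) = of_int (k * int n)" using n by (simp add: field_simps)
  then have "int ?N = k * int n" by (simp only: of_int_eq_iff)
  then have "int n dvd int ?N" by simp
  then show ?thesis by (simp only: of_nat_dvd_iff)
qed

end

section \<open>Restricted norms are natural numbers\<close>

lemma sum_div_mod:
  fixes F :: "nat \<Rightarrow> nat \<Rightarrow> complex"
  shows "(\<Sum>c<n * n. F (c div n) (c mod n)) = (\<Sum>l<n. \<Sum>m<n. F l m)"
proof (cases "n = 0")
  case False
  have "bij_betw (\<lambda>(l, m). l * n + m) ({..<n} \<times> {..<n}) {..<n * n}"
  proof (rule bij_betw_byWitness[where f' = "\<lambda>c. (c div n, c mod n)"])
    have "l * n + m < n * n" if "l < n" "m < n" for l m
    proof -
      have "l * n + m < Suc l * n" using that by simp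
      also have "\<dots> \<le> n * n" using that by (intro mult_le_mono1) simp
      finally show ?thesis .
    qed
    then show "(\<lambda>(l, m). l * n + m) ` ({..<n} \<times> {..<n}) \<subseteq> {..<n * n}" by auto
    show "(\<lambda>c. (c div n, c mod n)) ` {..<n * n} \<subseteq> {..<n} \<times> {..<n}"
      using False by (auto simp: less_mult_imp_div_less)
  qed auto
  from sum.reindex_bij_betw[OF this, of "\<lambda>c. F (c div n) (c mod n)", symmetric]
  have "(\<Sum>c<n * n. F (c div n) (c mod n)) = (\<Sum>(l, m)\<in>{..<n} \<times> {..<n}. F l m)"
    by (simp add: case_prod_unfold) (intro sum.cong refl, auto)
  then show ?thesis by (simp add: sum.cartesian_product)
qed simp

context fin_group
begin

text \<open>The mean of the matrices of a group action is idempotent, so its trace is a natural number (the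
  dimension of the fixed space). Multiplicativity suffices; the identity need not act as the unit
  matrix.\<close>

lemma mean_trace_Nats:
  assumes c: "\<And>x. x \<in> carrier G \<Longrightarrow> \<tau> x \<in> carrier_mat d d"
    and m: "\<And>x y. x \<in> carrier G \<Longrightarrow> y \<in> carrier G \<Longrightarrow> \<tau> (x \<otimes> y) = \<tau> x * \<tau> y"
  shows "(\<Sum>x\<in>carrier G. mat_trace (\<tau> x)) / of_nat (card (carrier G)) \<in> \<nat>"
proof -
  let ?N = "of_nat (card (carrier G)) :: complex"
  define M where "M = msum d d \<tau> (carrier G)"
  have M: "M \<in> carrier_mat d d" by (simp add: M_def)
  have yM: "\<tau> y * M = M" if y: "y \<in> carrier G" for y
  proof -
    have "\<tau> y * M = msum d d (\<lambda>x. \<tau> y * \<tau> x) (carrier G)"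
      unfolding M_def by (rule mult_msum[OF c[OF y] c])
    also have "\<dots> = M"
      unfolding M_def by (rule msum_reindex[OF bij_betw_mult_left[OF y], symmetric]) (simp add: m y)
    finally show ?thesis .
  qed
  have "M * M = msum d d (\<lambda>x. \<tau> x * M) (carrier G)"
    by (subst (1) M_def) (rule msum_mult[OF M c])
  also have "\<dots> = msum d d (\<lambda>x. M) (carrier G)" by (rule msum_cong) (rule yM)
  also have "\<dots> = ?N \<cdot>\<^sub>m M"
    using M by (intro eq_matI) (auto simp: msum_def)
  finally have MM: "M * M = ?N \<cdot>\<^sub>m M" .
  let ?P = "(1 / ?N) \<cdot>\<^sub>m M"
  have P: "?P \<in> carrier_mat d d" using M by simp
  have "?P * ?P = (1 / ?N) \<cdot>\<^sub>m ((1 / ?N) \<cdot>\<^sub>m (M * M))"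
    unfolding mult_smult_assoc_mat[OF M P] mult_smult_distrib[OF M M] ..
  also have "\<dots> = ?P"
    unfolding MM using card_pos M by (auto intro!: eq_matI)
  finally have "mat_trace ?P \<in> \<nat>" by (rule mat_trace_idempotent[OF P])
  moreover have "mat_trace M = (\<Sum>x\<in>carrier G. mat_trace (\<tau> x))"
    unfolding M_def by (rule mat_trace_msum[OF c])
  ultimately show ?thesis by (simp add: mat_trace_smult[OF M])
qed

text \<open>The action \<open>X \<mapsto> \<rho> x X \<rho> (x\<inverse>)\<close> on \<open>n \<times> n\<close> matrices, as a matrix of size
  \<open>n\<^sup>2\<close>. The index \<open>a < n\<^sup>2\<close> stands for the pair \<open>(a div n, a mod n)\<close>.\<close>

definition adjoint_rep :: "nat \<Rightarrow> ('a \<Rightarrow> complex mat) \<Rightarrow> 'a \<Rightarrow> complex mat" where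
  "adjoint_rep n \<rho> x = mat (n * n) (n * n)
     (\<lambda>(a, b). \<rho> x $$ (a div n, b div n) * \<rho> (inv x) $$ (b mod n, a mod n))"

lemma adjoint_rep_carrier [simp]: "adjoint_rep n \<rho> x \<in> carrier_mat (n * n) (n * n)"
  by (simp add: adjoint_rep_def)

lemma character_norm_Nats:
  assumes r: "representation G n \<rho>"
  shows "(\<Sum>x\<in>carrier G. mat_trace (\<rho> x) * mat_trace (\<rho> (inv x))) / of_nat (card (carrier G)) \<in> \<nat>"
proof -
  note rc = rep_carrier[OF r]
  have n: "n > 0" using rep_degree[OF r] .
  have dm: "a div n < n" "a mod n < n" if "a < n * n" for a
    using that n by (auto simp: less_mult_imp_div_less)
  have "mat_trace (\<rho> x) * mat_trace (\<rho> (inv x)) = mat_trace (adjoint_rep n \<rho> x)" if x: "x \<in> carrier G" for x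
  proof -
    have xi: "inv x \<in> carrier G" using x by simp
    have "mat_trace (adjoint_rep n \<rho> x)
        = (\<Sum>a<n * n. \<rho> x $$ (a div n, a div n) * \<rho> (inv x) $$ (a mod n, a mod n))"
      unfolding mat_trace_eq[OF adjoint_rep_carrier] by (intro sum.cong refl) (simp add: adjoint_rep_def)
    also have "\<dots> = (\<Sum>l<n. \<Sum>m<n. \<rho> x $$ (l, l) * \<rho> (inv x) $$ (m, m))" by (rule sum_div_mod)
    finally show ?thesis by (simp add: mat_trace_eq[OF rc[OF x]] mat_trace_eq[OF rc[OF xi]] sum_product)
  qed
  moreover have "adjoint_rep n \<rho> (x \<otimes> y) = adjoint_rep n \<rho> x * adjoint_rep n \<rho> y"
    if x: "x \<in> carrier G" and y: "y \<in> carrier G" for x y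
  proof (rule eq_matI)
    fix a b assume "a < dim_row (adjoint_rep n \<rho> x * adjoint_rep n \<rho> y)" "b < dim_col (adjoint_rep n \<rho> x * adjoint_rep n \<rho> y)"
    then have ab: "a < n * n" "b < n * n" by (auto simp: adjoint_rep_def)
    have i: "inv x \<in> carrier G" "inv y \<in> carrier G" using x y by auto
    have "(adjoint_rep n \<rho> x * adjoint_rep n \<rho> y) $$ (a, b)
        = (\<Sum>c<n * n. (\<rho> x $$ (a div n, c div n) * \<rho> y $$ (c div n, b div n))
            * (\<rho> (inv y) $$ (b mod n, c mod n) * \<rho> (inv x) $$ (c mod n, a mod n)))"
      unfolding index_mult_sum[OF adjoint_rep_carrier adjoint_rep_carrier ab]
      by (intro sum.cong refl) (use ab in \<open>simp add: adjoint_rep_def\<close>)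
    also have "\<dots> = (\<Sum>l<n. \<Sum>m<n. (\<rho> x $$ (a div n, l) * \<rho> y $$ (l, b div n))
            * (\<rho> (inv y) $$ (b mod n, m) * \<rho> (inv x) $$ (m, a mod n)))"
      by (rule sum_div_mod)
    also have "\<dots> = (\<rho> x * \<rho> y) $$ (a div n, b div n) * (\<rho> (inv y) * \<rho> (inv x)) $$ (b mod n, a mod n)"
      unfolding index_mult_sum[OF rc[OF x] rc[OF y] dm(1)[OF ab(1)] dm(1)[OF ab(2)]]
        index_mult_sum[OF rc[OF i(2)] rc[OF i(1)] dm(2)[OF ab(2)] dm(2)[OF ab(1)]] sum_product ..
    also have "\<dots> = adjoint_rep n \<rho> (x \<otimes> y) $$ (a, b)"
      using ab x y i by (simp add: adjoint_rep_def inv_mult_group rep_mult[OF r] del: index_mult_mat)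
    finally show "adjoint_rep n \<rho> (x \<otimes> y) $$ (a, b) = (adjoint_rep n \<rho> x * adjoint_rep n \<rho> y) $$ (a, b)" by simp
  qed (auto simp: adjoint_rep_def)
  ultimately show ?thesis using mean_trace_Nats[of "adjoint_rep n \<rho>" "n * n"] by simp
qed

section \<open>Sums of characters\<close>

text \<open>The direct sum is block diagonal.\<close>

lemma characters_add:
  assumes "\<alpha> \<in> characters G" "\<beta> \<in> characters G"
  shows "(\<lambda>g\<in>carrier G. \<alpha> g + \<beta> g) \<in> characters G"
proof -
  obtain n \<rho> where r: "representation G n \<rho>" and \<alpha>: "\<alpha> = character_of G \<rho>"
    using assms(1) by (auto simp: characters_def)
  obtain m \<sigma> where s: "representation G m \<sigma>" and \<beta>: "\<beta> = character_of G \<sigma>"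
    using assms(2) by (auto simp: characters_def)
  note rc = rep_carrier[OF r] and sc = rep_carrier[OF s]
  define \<tau> where "\<tau> g = four_block_mat (\<rho> g) (0\<^sub>m n m) (0\<^sub>m m n) (\<sigma> g)" for g
  have "representation G (n + m) \<tau>"
  proof (rule representationI)
    show "n + m > 0" using rep_degree[OF r] by simp
    show "\<tau> \<one> = 1\<^sub>m (n + m)" by (simp add: \<tau>_def rep_one[OF r] rep_one[OF s])
    fix g assume g: "g \<in> carrier G"
    show "\<tau> g \<in> carrier_mat (n + m) (n + m)" using rc[OF g] sc[OF g] by (simp add: \<tau>_def)
    fix h assume h: "h \<in> carrier G"
    show "\<tau> (g \<otimes> h) = \<tau> g * \<tau> h"
      unfolding \<tau>_def rep_mult[OF r g h] rep_mult[OF s g h]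
      using rc[OF g] sc[OF g] rc[OF h] sc[OF h]
      by (subst mult_four_block_mat[of _ n n _ m _ m _ _ n _ m]) auto
  qed
  moreover have "(\<lambda>g\<in>carrier G. \<alpha> g + \<beta> g) = character_of G \<tau>"
    unfolding character_of_def
  proof (rule restrict_ext)
    fix g assume g: "g \<in> carrier G"
    have "mat_trace (\<tau> g) = (\<Sum>i<n + m. if i < n then \<rho> g $$ (i, i) else \<sigma> g $$ (i - n, i - n))"
      unfolding \<tau>_def mat_trace_eq[OF four_block_carrier_mat[OF rc[OF g] sc[OF g]]]
      using rc[OF g] sc[OF g] by (intro sum.cong refl) auto
    also have "\<dots> = mat_trace (\<rho> g) + mat_trace (\<sigma> g)"
    proof -
      have split: "sum F {..<n + m} = (\<Sum>i<n. F i) + (\<Sum>i<m. F (n + i))" for F :: "nat \<Rightarrow> complex"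
        by (induction m) (simp_all add: add.assoc)
      show ?thesis by (simp add: split mat_trace_eq[OF rc[OF g]] mat_trace_eq[OF sc[OF g]])
    qed
    finally show "\<alpha> g + \<beta> g = mat_trace (\<tau> g)" using g by (simp add: \<alpha> \<beta> character_of_eq)
  qed
  ultimately show ?thesis by (auto simp: characters_def)
qed

text \<open>The characters together with the zero function, which is not a character since degrees are
  positive. This set is closed under linear combinations with natural coefficients.\<close>

definition characters0 :: "('a \<Rightarrow> complex) set" where
  "characters0 = insert (\<lambda>g\<in>carrier G. 0) (characters G)"

lemma characters_restrict: "\<alpha> \<in> characters G \<Longrightarrow> (\<lambda>g\<in>carrier G. \<alpha> g) = \<alpha>"
  by (auto simp: characters_def character_of_def)

lemma characters0_add:
  assumes "(\<lambda>g\<in>carrier G. \<alpha> g) \<in> characters0" "(\<lambda>g\<in>carrier G. \<beta> g) \<in> characters0"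
  shows "(\<lambda>g\<in>carrier G. \<alpha> g + \<beta> g) \<in> characters0"
proof -
  let ?a = "\<lambda>g\<in>carrier G. \<alpha> g" and ?b = "\<lambda>g\<in>carrier G. \<beta> g"
  have eq: "(\<lambda>g\<in>carrier G. \<alpha> g + \<beta> g) = (\<lambda>g\<in>carrier G. ?a g + ?b g)" by (intro restrict_ext) simp
  consider "?a \<in> characters G" "?b \<in> characters G" | "?a = (\<lambda>g\<in>carrier G. 0)" | "?b = (\<lambda>g\<in>carrier G. 0)"
    using assms by (auto simp: characters0_def)
  then show ?thesis
  proof cases
    case 1
    then show ?thesis unfolding eq characters0_def by (intro insertI2 characters_add)
  next
    case 2
    then have "\<alpha> g = 0" if "g \<in> carrier G" for g using that by (metis restrict_apply')
    then have "(\<lambda>g\<in>carrier G. \<alpha> g + \<beta> g) = ?b" by (intro restrict_ext) simp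
    then show ?thesis using assms by simp
  next
    case 3
    then have "\<beta> g = 0" if "g \<in> carrier G" for g using that by (metis restrict_apply')
    then have "(\<lambda>g\<in>carrier G. \<alpha> g + \<beta> g) = ?a" by (intro restrict_ext) simp
    then show ?thesis using assms by simp
  qed
qed

lemma characters0_mult:
  assumes "\<chi> \<in> characters G"
  shows "(\<lambda>g\<in>carrier G. of_nat k * \<chi> g) \<in> characters0"
proof (induction k)
  case 0
  have "(\<lambda>g\<in>carrier G. of_nat 0 * \<chi> g) = (\<lambda>g\<in>carrier G. 0)" by (intro restrict_ext) simp
  then show ?case by (simp only: characters0_def insertI1)
next
  case (Suc k)
  have "(\<lambda>g\<in>carrier G. \<chi> g) \<in> characters0" using assms by (simp add: characters_restrict characters0_def)
  from characters0_add[OF this Suc] show ?case by (simp only: of_nat_Suc distrib_right mult_1)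
qed

lemma characters0_sum:
  assumes "finite S" "S \<subseteq> characters G" "\<And>\<chi>. \<chi> \<in> S \<Longrightarrow> q \<chi> \<in> \<nat>"
  shows "(\<lambda>g\<in>carrier G. \<Sum>\<chi>\<in>S. q \<chi> * \<chi> g) \<in> characters0"
  using assms
proof (induction S rule: finite_induct)
  case empty
  show ?case by (simp only: characters0_def insertI1 sum.empty)
next
  case (insert \<chi> S)
  obtain k where k: "q \<chi> = of_nat k" using insert.prems(2)[of \<chi>] by (auto simp: Nats_def)
  have "(\<lambda>g\<in>carrier G. q \<chi> * \<chi> g) \<in> characters0" unfolding k by (rule characters0_mult) (use insert.prems in simp)
  moreover have "(\<lambda>g\<in>carrier G. \<Sum>\<chi>\<in>S. q \<chi> * \<chi> g) \<in> characters0" using insert by blast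
  ultimately show ?case unfolding sum.insert[OF insert.hyps] by (rule characters0_add)
qed

lemma Irr_subset_characters: "Irr G \<subseteq> characters G"
  unfolding Irr_def characters_def using irr_rep by blast

section \<open>The counting function\<close>

text \<open>Let \<open>w\<close> be the product in the definition of \<^const>\<open>zeta3\<close>. Expanding the indicator of
  \<open>w\<inverse> g = \<one>\<close> by the regular character makes the sum over the two conjugating variables a twofold
  application of \<open>Irr_conj_sum\<close>.\<close>

theorem zeta3_formula:
  assumes H: "H \<subseteq> carrier G" and g: "g \<in> carrier G"
  shows "of_nat (zeta3 G H g)
    = (\<Sum>\<chi>\<in>Irr G. of_nat (card (carrier G)) * (\<Sum>h\<in>H. \<chi> h * \<chi> (inv h)) / \<chi> \<one> * \<chi> g)"
proof -
  let ?N = "of_nat (card (carrier G)) :: complex"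
  let ?w = "\<lambda>x h y. x \<otimes> h \<otimes> inv x \<otimes> y \<otimes> inv h \<otimes> inv y"
  let ?c = "\<lambda>x h y. y \<otimes> h \<otimes> inv y \<otimes> (x \<otimes> inv h \<otimes> inv x \<otimes> g)"
  have fH: "finite H" using H fin by (rule finite_subset)
  have N: "?N \<noteq> 0" using card_pos by simp
  have c: "?c x h y \<in> carrier G" if "x \<in> carrier G" "h \<in> H" "y \<in> carrier G" for x h y using that H g by auto
  have c1: "?c x h y = \<one> \<longleftrightarrow> ?w x h y = g" if "x \<in> carrier G" "h \<in> H" "y \<in> carrier G" for x h y
  proof -
    have h: "h \<in> carrier G" using that H by auto
    have w: "?w x h y \<in> carrier G" using that h by simp
    have "?c x h y = inv (?w x h y) \<otimes> g" using that h g by (simp add: inv_mult_group m_assoc)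
    then show ?thesis using w g by (metis inv_closed inv_solve_left r_one one_closed)
  qed
  have "of_nat (zeta3 G H g) = (\<Sum>p\<in>carrier G \<times> H \<times> carrier G. (case p of (x, h, y) \<Rightarrow> if ?w x h y = g then 1 else 0) :: complex)"
  proof -
    have "finite (carrier G \<times> H \<times> carrier G)" using fin fH by simp
    moreover have "{(x, h, y) \<in> carrier G \<times> H \<times> carrier G. ?w x h y = g}
      = (carrier G \<times> H \<times> carrier G) \<inter> {p. case p of (x, h, y) \<Rightarrow> ?w x h y = g}" by auto
    ultimately show ?thesis
      unfolding zeta3_def by (simp add: case_prod_unfold sum.If_cases)
  qed
  also have "\<dots> = (\<Sum>x\<in>carrier G. \<Sum>h\<in>H. \<Sum>y\<in>carrier G. if ?w x h y = g then 1 else 0)"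
    unfolding sum.cartesian_product by (intro sum.cong) auto
  also have "\<dots> = (\<Sum>x\<in>carrier G. \<Sum>h\<in>H. \<Sum>y\<in>carrier G. (\<Sum>\<chi>\<in>Irr G. \<chi> \<one> * \<chi> (?c x h y)) / ?N)"
    using card_pos by (intro sum.cong refl) (simp add: regular_character[OF c] c1)
  also have "\<dots> = (\<Sum>\<chi>\<in>Irr G. \<Sum>h\<in>H. \<chi> \<one> / ?N * (\<Sum>x\<in>carrier G. \<Sum>y\<in>carrier G. \<chi> (?c x h y)))"
  proof -
    have "(\<Sum>x\<in>carrier G. \<Sum>h\<in>H. \<Sum>y\<in>carrier G. (\<Sum>\<chi>\<in>Irr G. \<chi> \<one> * \<chi> (?c x h y)) / ?N)
        = (\<Sum>x\<in>carrier G. \<Sum>h\<in>H. \<Sum>y\<in>carrier G. \<Sum>\<chi>\<in>Irr G. \<chi> \<one> / ?N * \<chi> (?c x h y))"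
      by (simp add: sum_divide_distrib)
    also have "\<dots> = (\<Sum>x\<in>carrier G. \<Sum>h\<in>H. \<Sum>\<chi>\<in>Irr G. \<Sum>y\<in>carrier G. \<chi> \<one> / ?N * \<chi> (?c x h y))"
      by (intro sum.cong refl sum.swap)
    also have "\<dots> = (\<Sum>x\<in>carrier G. \<Sum>\<chi>\<in>Irr G. \<Sum>h\<in>H. \<Sum>y\<in>carrier G. \<chi> \<one> / ?N * \<chi> (?c x h y))"
      by (intro sum.cong refl sum.swap)
    also have "\<dots> = (\<Sum>\<chi>\<in>Irr G. \<Sum>x\<in>carrier G. \<Sum>h\<in>H. \<Sum>y\<in>carrier G. \<chi> \<one> / ?N * \<chi> (?c x h y))"
      by (rule sum.swap)
    also have "\<dots> = (\<Sum>\<chi>\<in>Irr G. \<Sum>h\<in>H. \<Sum>x\<in>carrier G. \<Sum>y\<in>carrier G. \<chi> \<one> / ?N * \<chi> (?c x h y))"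
      by (intro sum.cong refl sum.swap)
    finally show ?thesis by (simp only: sum_distrib_left)
  qed
  also have "\<dots> = (\<Sum>\<chi>\<in>Irr G. ?N * (\<Sum>h\<in>H. \<chi> h * \<chi> (inv h)) / \<chi> \<one> * \<chi> g)"
  proof (intro sum.cong refl)
    fix \<chi> assume \<chi>: "\<chi> \<in> Irr G"
    have "\<chi> \<one> / ?N * (\<Sum>x\<in>carrier G. \<Sum>y\<in>carrier G. \<chi> (?c x h y)) = ?N / \<chi> \<one> * \<chi> g * (\<chi> h * \<chi> (inv h))"
      if "h \<in> H" for h
    proof -
      have h: "h \<in> carrier G" "inv h \<in> carrier G" using that H by auto
      have "(\<Sum>x\<in>carrier G. \<Sum>y\<in>carrier G. \<chi> (?c x h y))
          = (\<Sum>x\<in>carrier G. ?N * \<chi> h / \<chi> \<one> * \<chi> (x \<otimes> inv h \<otimes> inv x \<otimes> g))"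
        using h g by (intro sum.cong refl Irr_conj_sum[OF \<chi>]) auto
      also have "\<dots> = ?N * \<chi> h / \<chi> \<one> * (?N * \<chi> (inv h) / \<chi> \<one> * \<chi> g)"
        by (simp only: sum_distrib_left[symmetric] Irr_conj_sum[OF \<chi> h(2) g])
      finally show ?thesis using N Irr_one_nonzero[OF \<chi>] by (simp add: field_simps)
    qed
    then have "(\<Sum>h\<in>H. \<chi> \<one> / ?N * (\<Sum>x\<in>carrier G. \<Sum>y\<in>carrier G. \<chi> (?c x h y)))
        = ?N / \<chi> \<one> * \<chi> g * (\<Sum>h\<in>H. \<chi> h * \<chi> (inv h))"
      by (simp add: sum_distrib_left)
    then show "(\<Sum>h\<in>H. \<chi> \<one> / ?N * (\<Sum>x\<in>carrier G. \<Sum>y\<in>carrier G. \<chi> (?c x h y)))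
        = ?N * (\<Sum>h\<in>H. \<chi> h * \<chi> (inv h)) / \<chi> \<one> * \<chi> g" by simp
  qed
  finally show ?thesis .
qed

lemma class_inner_subgroup:
  assumes \<chi>: "\<chi> \<in> Irr G" and H: "subgroup H G"
  shows "class_inner (G\<lparr>carrier := H\<rparr>) (restrict \<chi> H) (restrict \<chi> H)
    = (\<Sum>h\<in>H. \<chi> h * \<chi> (inv h)) / of_nat (card H)"
  using subgroup.mem_carrier[OF H] by (simp add: class_inner_def Irr_inv[OF \<chi>])

lemma class_inner_subgroup_Nats:
  assumes \<chi>: "\<chi> \<in> Irr G" and H: "subgroup H G"
  shows "class_inner (G\<lparr>carrier := H\<rparr>) (restrict \<chi> H) (restrict \<chi> H) \<in> \<nat>"
proof -
  obtain n \<rho> where r: "irreducible_representation G n \<rho>" and tr: "\<And>g. g \<in> carrier G \<Longrightarrow> \<chi> g = mat_trace (\<rho> g)"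
    using \<chi> by (elim IrrE) blast
  note rr = irr_rep[OF r] and Hc = subgroup.mem_carrier[OF H]
  interpret H: fin_group "G\<lparr>carrier := H\<rparr>"
    using subgroup.subgroup_is_group[OF H is_group] finite_subset[OF subgroup.subset[OF H] fin]
    by (simp add: fin_group_def fin_group_axioms_def)
  have "representation (G\<lparr>carrier := H\<rparr>) n \<rho>"
    by (rule H.representationI)
      (use rep_degree[OF rr] rep_carrier[OF rr] rep_mult[OF rr] rep_one[OF rr] Hc in auto)
  from H.character_norm_Nats[OF this]
  show ?thesis
    unfolding class_inner_subgroup[OF \<chi> H] using Hc by (simp add: tr m_inv_consistent[OF H])
qed

end

theorem proposition3p3p4:
  fixes G :: "('a, 'm) monoid_scheme" and H :: "'a set"
  assumes "group G" and "finite (carrier G)" and "subgroup H G"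
  shows "(\<lambda>g\<in>carrier G. of_nat (zeta3 G H g)) \<in> characters G \<and>
    (\<forall>g\<in>carrier G. of_nat (zeta3 G H g) =
      (\<Sum>\<chi>\<in>Irr G.
         of_nat (card (carrier G)) * of_nat (card H)
           * class_inner (G\<lparr>carrier := H\<rparr>) (restrict \<chi> H) (restrict \<chi> H)
           / \<chi> \<one>\<^bsub>G\<^esub> * \<chi> g))"
proof -
  interpret fin_group G using assms by (simp add: fin_group_def fin_group_axioms_def)
  let ?N = "of_nat (card (carrier G)) :: complex"
  let ?I = "\<lambda>\<chi>. class_inner (G\<lparr>carrier := H\<rparr>) (restrict \<chi> H) (restrict \<chi> H)"
  let ?q = "\<lambda>\<chi>. ?N * of_nat (card H) * ?I \<chi> / \<chi> \<one>\<^bsub>G\<^esub>"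
  note H = assms(3)
  have HG: "H \<subseteq> carrier G" using subgroup.subset[OF H] .
  have "card H > 0"
    using finite_subset[OF HG fin] subgroup.one_closed[OF H] by (auto simp: card_gt_0_iff)
  then have formula: "of_nat (zeta3 G H g) = (\<Sum>\<chi>\<in>Irr G. ?q \<chi> * \<chi> g)" if "g \<in> carrier G" for g
    unfolding zeta3_formula[OF HG that]
    by (intro sum.cong refl) (simp add: class_inner_subgroup[OF _ H])
  have "?q \<chi> \<in> \<nat>" if \<chi>: "\<chi> \<in> Irr G" for \<chi>
  proof -
    obtain n \<rho> where r: "irreducible_representation G n \<rho>" and n: "n > 0" "\<chi> \<one>\<^bsub>G\<^esub> = of_nat n"
      using \<chi> by (elim IrrE) blast
    obtain k where "card (carrier G) = n * k" using degree_dvd_order[OF r] by (auto elim: dvdE)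
    then have "?q \<chi> = of_nat (k * card H) * ?I \<chi>" using n by simp
    then show ?thesis using class_inner_subgroup_Nats[OF \<chi> H] by (simp only: Nats_mult of_nat_in_Nats)
  qed
  then have "(\<lambda>g\<in>carrier G. \<Sum>\<chi>\<in>Irr G. ?q \<chi> * \<chi> g) \<in> characters0"
    by (intro characters0_sum finite_Irr Irr_subset_characters)
  moreover have "(\<lambda>g\<in>carrier G. of_nat (zeta3 G H g)) = (\<lambda>g\<in>carrier G. \<Sum>\<chi>\<in>Irr G. ?q \<chi> * \<chi> g)"
    by (intro restrict_ext formula)
  \<comment> \<open>The triple of identity elements is a solution for \<open>g = \<one>\<close>.\<close>
  moreover have "(\<lambda>g\<in>carrier G. of_nat (zeta3 G H g)) \<noteq> (\<lambda>g\<in>carrier G. 0 :: complex)"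
  proof
    assume "(\<lambda>g\<in>carrier G. of_nat (zeta3 G H g)) = (\<lambda>g\<in>carrier G. 0 :: complex)"
    from fun_cong[OF this, of "\<one>\<^bsub>G\<^esub>"] have "zeta3 G H \<one>\<^bsub>G\<^esub> = 0" by simp
    moreover have "finite (carrier G \<times> H \<times> carrier G)" using fin finite_subset[OF HG fin] by simp
    then have "finite {(g1, h2, g3) \<in> carrier G \<times> H \<times> carrier G.
       g1 \<otimes>\<^bsub>G\<^esub> h2 \<otimes>\<^bsub>G\<^esub> inv\<^bsub>G\<^esub> g1 \<otimes>\<^bsub>G\<^esub> g3 \<otimes>\<^bsub>G\<^esub> inv\<^bsub>G\<^esub> h2 \<otimes>\<^bsub>G\<^esub> inv\<^bsub>G\<^esub> g3 = \<one>\<^bsub>G\<^esub>}"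
      (is "finite ?S") by (rule rev_finite_subset) auto
    ultimately have "?S = {}" by (simp only: zeta3_def card_0_eq)
    moreover have "(\<one>\<^bsub>G\<^esub>, \<one>\<^bsub>G\<^esub>, \<one>\<^bsub>G\<^esub>) \<in> ?S"
      using subgroup.one_closed[OF H] by simp
    ultimately show False by blast
  qed
  ultimately show ?thesis using formula by (simp add: characters0_def)
qed

end
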